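(* There exists a constant $C>1$ such that for all $n,k\in\mathbb{N}$ the following holds. If $X=[n]$ and a function $g\colon\binom{X}{k}\to[0,1]$ is such that $\operatorname{supp}(g)$ consists only of $k$-APs and $w(g,p)=1$ for some $p\in[0,1]$, then $\langle g\rangle$ is $\frac{p}{C}$-small.
   Context: $\mathbb{N}=\{1,2,\dots\}$, $[n]=\{1,\dots,n\}$. For a finite set $X$, $2^X$ is its power set and $\binom{X}{k}$ is the set of $k$-element subsets of $X$. A $k$-AP ($k$-term arithmetic progression) is a set of the form $\{a,a+d,\dots,a+(k-1)d\}$ with $d\ne 0$. For $p\in[0,1]$, $G\subseteq 2^X$ and $g\colon 2^X\to[0,\infty)$ define $$w(G,p):=\sum_{T\in G}p^{|T|},\qquad w(g,p):=\sum_{T\in 2^X}g(T)\,p^{|T|},$$ $$\langle G\rangle:=\{S\in 2^X : \text{there is } T\in G \text{ with } T\subseteq S\},\qquad \langle g\rangle:=\Big\{S\in 2^X : \sum_{T\subseteq S}g(T)\ge 1\Big\}.$$ A function defined only on $\binom{X}{k}$ is regarded as a function on $2^X$ by setting it to $0$ outside $\binom{X}{k}$. The support of $g$ is $\operatorname{supp}(g):=\{S : g(S)\ne 0\}$. A family $\mathcal{F}\subseteq 2^X$ is called $p$-small if there exists a set $G\subseteq 2^X$ with $\mathcal{F}\subseteq\langle G\rangle$ and $w(G,p)\le\frac12$. *)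

theory Defs
  imports "HOL-Analysis.Analysis" "HOL-Library.Ramsey"
begin

text \<open>
  Throughout, \<open>X\<close> is a finite ground set and families are subsets of \<open>Pow X\<close>, so all sums below
  range over finite sets. The set of \<open>k\<close>-element subsets of \<open>X\<close> is \<open>nsets X k\<close>.
\<close>

text \<open>
  On natural numbers, a progression with a negative difference is, as a set, the progression with
  the opposite difference started at its other end, so a natural difference loses nothing.
\<close>

definition is_AP :: "nat \<Rightarrow> nat set \<Rightarrow> bool" where
  "is_AP k S \<longleftrightarrow> (\<exists>a d. d \<noteq> 0 \<and> S = (\<lambda>i. a + i * d) ` {..<k})"

definition family_weight :: "'a set set \<Rightarrow> real \<Rightarrow> real" where
  "family_weight G p = (\<Sum>T\<in>G. p ^ card T)"

definition fun_weight :: "'a set \<Rightarrow> ('a set \<Rightarrow> real) \<Rightarrow> real \<Rightarrow> real" where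
  "fun_weight X g p = (\<Sum>T\<in>Pow X. g T * p ^ card T)"

definition family_upset :: "'a set \<Rightarrow> 'a set set \<Rightarrow> 'a set set" where
  "family_upset X G = {S \<in> Pow X. \<exists>T\<in>G. T \<subseteq> S}"

definition fun_upset :: "'a set \<Rightarrow> ('a set \<Rightarrow> real) \<Rightarrow> 'a set set" where
  "fun_upset X g = {S \<in> Pow X. (\<Sum>T\<in>Pow S. g T) \<ge> 1}"

definition p_small :: "'a set \<Rightarrow> real \<Rightarrow> 'a set set \<Rightarrow> bool" where
  "p_small X p F \<longleftrightarrow> (\<exists>G \<subseteq> Pow X. F \<subseteq> family_upset X G \<and> family_weight G p \<le> 1 / 2)"

definition zero_extension :: "'b set \<Rightarrow> ('b \<Rightarrow> real) \<Rightarrow> 'b \<Rightarrow> real" where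
  "zero_extension A g = (\<lambda>T. if T \<in> A then g T else 0)"

end

theory Submission
  imports Defs
begin

text \<open>
  Divide \<open>p\<close> by \<open>C\<close>. Then the total weight of \<open>g\<close> drops from 1 to \<open>1 / C ^ k\<close>, which beats every
  polynomial in \<open>k\<close>, and it suffices to cover the sets \<open>S\<close> that contain edges of total weight at
  least 1, at bounded cost. The proof rests on the fact that two distinct
  points lie together in at most \<open>k\<^sup>2\<close> progressions; the result holds for all \<open>k\<close>-uniform hypergraphs
  with this codegree condition (\<open>p_small_if_codegree_le_square\<close>).

  Think of a random set that contains each point with probability \<open>p\<close>. A set \<open>S\<close> of weight at least
  1 is untypical, and the cover must list small substructures, one of which each such \<open>S\<close> contains.
  Edges of large weight are listed directly. If the points of \<open>S\<close> have a large sum of expected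
  degrees, this is a statement about weighted points, and suitable sets of points are listed
  (\<open>coverable_heavy_points\<close>). Otherwise the dyadic levels of \<open>g\<close> reduce the problem to unweighted
  hypergraphs: on some level \<open>S\<close> contains many more edges than the expected number and than the
  expected degrees of its points account for.

  Since edges overlap, sets of many edges cannot be listed cheaply. What is listed instead are
  bouquets: \<open>n\<close> centres, each with \<open>t\<close> edges that meet only in the centre, all disjoint from the
  edges at other centres. A bouquet pays for all of its points, so the list of bouquets is
  cheap as soon as \<open>t\<close> exceeds a multiple of the expected degrees of the centres and \<open>n\<close> is not
  smaller than \<open>exp (6 - 2 * t)\<close> times \<open>k\<close> times the expected number of edges
  (\<open>coverable_bouquets\<close>). Both
  extremes occur: large matchings, where \<open>t = 1\<close>, and stars, where \<open>n = 1\<close>.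

  Finding a cheap bouquet in \<open>S\<close> is a greedy argument. Charge every edge to its vertex of largest
  degree in \<open>S\<close>, and choose a maximal family of disjoint sunflowers, where the one with centre \<open>v\<close> has
  a number \<open>t v\<close> of petals proportional to the degree of \<open>v\<close>. By the codegree condition, maximality
  forces the sum of \<open>(t v)\<^sup>2\<close> to be of the order of the number of edges in \<open>S\<close>
  (\<open>disjoint_sunflower_system\<close>). If no value of \<open>t v\<close> gave a cheap bouquet, this sum would be too
  small (\<open>coverable_many_edges\<close>).
\<close>

section \<open>Covers and their cost\<close>

text \<open>
  The cost is a parameter here, so that the costs of covers for several reasons can be added.
\<close>

definition coverable :: "'a set \<Rightarrow> real \<Rightarrow> real \<Rightarrow> 'a set set \<Rightarrow> bool" where
  "coverable X p c F \<longleftrightarrow> (\<exists>G \<subseteq> Pow X. F \<subseteq> family_upset X G \<and> family_weight G p \<le> c)"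

lemma coverableI:
  assumes "G \<subseteq> Pow X" "F \<subseteq> family_upset X G" "family_weight G p \<le> c"
  shows "coverable X p c F"
  unfolding coverable_def using assms by (intro exI conjI)

lemma coverableE:
  assumes "coverable X p c F"
  obtains G where "G \<subseteq> Pow X" "F \<subseteq> family_upset X G" "family_weight G p \<le> c"
  using assms unfolding coverable_def by (elim exE conjE)

lemma p_small_iff_coverable: "p_small X p F \<longleftrightarrow> coverable X p (1/2) F"
  by (simp add: p_small_def coverable_def)

lemma coverable_mono:
  assumes "coverable X p c F" "F' \<subseteq> F" "c \<le> c'"
  shows "coverable X p c' F'"
proof -
  obtain G where G: "G \<subseteq> Pow X" "F \<subseteq> family_upset X G" "family_weight G p \<le> c"
    using assms(1) by (rule coverableE)
  show ?thesis
    using coverableI[OF G(1) order_trans[OF assms(2) G(2)] order_trans[OF G(3) assms(3)]] .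
qed

lemma coverable_empty: "coverable X p 0 {}"
  by (rule coverableI[of "{}"]) (simp_all add: family_weight_def)

lemma family_upset_Un: "family_upset X (G \<union> G') = family_upset X G \<union> family_upset X G'"
  by (auto simp: family_upset_def)

lemma coverable_Un:
  assumes "finite X" "0 \<le> p" "coverable X p c F" "coverable X p c' F'"
  shows "coverable X p (c + c') (F \<union> F')"
proof -
  obtain G where G: "G \<subseteq> Pow X" "F \<subseteq> family_upset X G" "family_weight G p \<le> c"
    using assms(3) by (rule coverableE)
  obtain G' where G': "G' \<subseteq> Pow X" "F' \<subseteq> family_upset X G'" "family_weight G' p \<le> c'"
    using assms(4) by (rule coverableE)
  have fin: "finite G" "finite G'"
    using G(1) G'(1) assms(1) by (auto intro: finite_subset)
  have "family_weight (G \<union> G') p + (\<Sum>T\<in>G \<inter> G'. p ^ card T) = family_weight G p + family_weight G' p"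
    unfolding family_weight_def by (rule sum.union_inter[OF fin])
  moreover have "0 \<le> (\<Sum>T\<in>G \<inter> G'. p ^ card T)"
    using assms(2) by (intro sum_nonneg) auto
  ultimately have "family_weight (G \<union> G') p \<le> c + c'"
    using G(3) G'(3) by linarith
  moreover have "F \<union> F' \<subseteq> family_upset X (G \<union> G')"
    unfolding family_upset_Un using G(2) G'(2) by (rule Un_mono)
  ultimately show ?thesis
    using G(1) G'(1) by (intro coverableI[of "G \<union> G'"]) auto
qed

lemma coverable_UN:
  assumes "finite X" "0 \<le> p" "finite I" "\<And>i. i \<in> I \<Longrightarrow> coverable X p (c i) (F i)"
  shows "coverable X p (\<Sum>i\<in>I. c i) (\<Union>i\<in>I. F i)"
  using assms(3,4)
proof (induction I rule: finite_induct)
  case empty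
  then show ?case by (simp add: coverable_empty)
next
  case (insert i I)
  have "coverable X p (c i) (F i)"
    by (rule insert.prems) simp
  moreover have "coverable X p (sum c I) (\<Union>i\<in>I. F i)"
    by (rule insert.IH, rule insert.prems) simp
  ultimately have "coverable X p (c i + sum c I) (F i \<union> (\<Union>i\<in>I. F i))"
    by (rule coverable_Un[OF assms(1,2)])
  then show ?case
    using insert.hyps by simp
qed

lemma coverable_image:
  assumes "finite I" "0 \<le> p" "\<And>i. i \<in> I \<Longrightarrow> u i \<subseteq> X" "(\<Sum>i\<in>I. p ^ card (u i)) \<le> c"
  shows "coverable X p c {S \<in> Pow X. \<exists>i\<in>I. u i \<subseteq> S}"
proof -
  have "(\<Sum>T\<in>u ` I. p ^ card T) \<le> (\<Sum>i\<in>I. p ^ card (u i))"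
    using sum_image_le[OF assms(1), of "\<lambda>T. p ^ card T" u] assms(2) by (simp add: o_def)
  then have "family_weight (u ` I) p \<le> c"
    unfolding family_weight_def using assms(4) by (rule order_trans)
  moreover have "u ` I \<subseteq> Pow X" using assms(3) by auto
  moreover have "{S \<in> Pow X. \<exists>i\<in>I. u i \<subseteq> S} \<subseteq> family_upset X (u ` I)"
    by (auto simp: family_upset_def)
  ultimately show ?thesis by (intro coverableI)
qed

section \<open>Elementary symmetric sums\<close>

text \<open>
  Markov's inequality for the generating function: the sum is a coefficient of the polynomial
  \<open>\<Prod>v\<in>A. 1 + z * a v\<close>, which is at most \<open>exp (z * sum a A)\<close>, and \<open>z = n / sum a A\<close> is optimal.
\<close>

lemma sum_prod_nsets_le:
  fixes a :: "'a \<Rightarrow> real"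
  assumes "finite A" "\<And>v. v \<in> A \<Longrightarrow> 0 \<le> a v" "n \<ge> 1"
  shows "(\<Sum>V\<in>nsets A n. \<Prod>v\<in>V. a v) \<le> (exp 1 * sum a A / n) ^ n"
proof (cases "sum a A = 0")
  case True
  then have z: "a v = 0" if "v \<in> A" for v
    using assms that by (simp add: sum_nonneg_eq_0_iff)
  have "(\<Prod>v\<in>V. a v) = 0" if "V \<in> nsets A n" for V
  proof -
    have "V \<noteq> {}" "finite V" "V \<subseteq> A" using that \<open>n \<ge> 1\<close> by (auto simp: nsets_def)
    then show ?thesis using z by (auto intro!: prod_zero)
  qed
  then have "(\<Sum>V\<in>nsets A n. \<Prod>v\<in>V. a v) = 0" by simp
  then show ?thesis using True \<open>n \<ge> 1\<close> by simp
next
  case False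
  then have s: "sum a A > 0" using assms(2) by (simp add: sum_nonneg order_less_le)
  define z where "z = n / sum a A"
  have z: "z > 0" using s assms(3) by (simp add: z_def)
  have "z ^ n * (\<Sum>V\<in>nsets A n. \<Prod>v\<in>V. a v) = (\<Sum>V\<in>nsets A n. \<Prod>v\<in>V. z * a v)"
    by (auto simp: sum_distrib_left nsets_def prod.distrib intro!: sum.cong)
  also have "\<dots> \<le> (\<Sum>V\<in>Pow A. \<Prod>v\<in>V. z * a v)"
    using assms z by (intro sum_mono2 prod_nonneg) (auto simp: nsets_def subset_iff)
  also have "\<dots> = (\<Prod>v\<in>A. z * a v + 1)"
    using prod_add[OF assms(1), of "\<lambda>v. z * a v" "\<lambda>_. 1"] by simp
  also have "\<dots> \<le> (\<Prod>v\<in>A. exp (z * a v))"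
    using assms z by (intro prod_mono) (auto simp: add.commute)
  also have "\<dots> = exp (z * sum a A)"
    using assms(1) by (simp add: exp_sum sum_distrib_left)
  also have "\<dots> = exp 1 ^ n"
    using s by (simp add: z_def exp_of_nat_mult[symmetric])
  finally have "(\<Sum>V\<in>nsets A n. \<Prod>v\<in>V. a v) \<le> exp 1 ^ n / z ^ n"
    using z by (simp add: field_simps)
  also have "\<dots> = (exp 1 * sum a A / n) ^ n"
    using assms(3) s by (simp add: z_def power_divide power_mult_distrib)
  finally show ?thesis .
qed

lemma card_nsets_eq:
  assumes "finite A"
  shows "card (nsets A n) = card A choose n"
proof -
  have "nsets A n = {B. B \<subseteq> A \<and> card B = n}"
    using assms by (auto simp: nsets_def intro: finite_subset)
  then show ?thesis using n_subsets[OF assms] by simp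
qed

section \<open>Sunflowers in hypergraphs of bounded codegree\<close>

definition sunflower :: "'a \<Rightarrow> 'a set set \<Rightarrow> bool" where
  "sunflower v F \<longleftrightarrow> (\<forall>T\<in>F. v \<in> T) \<and> pairwise (\<lambda>T T'. T \<inter> T' = {v}) F"

lemma sunflower_subset: "sunflower v F \<Longrightarrow> F' \<subseteq> F \<Longrightarrow> sunflower v F'"
  unfolding sunflower_def by (meson pairwise_subset subset_iff)

lemma card_Union_sunflower:
  assumes "sunflower v F" "finite F" "F \<noteq> {}" "\<And>T. T \<in> F \<Longrightarrow> finite T \<and> card T = k"
  shows "card (\<Union>F) = 1 + (k - 1) * card F"
proof -
  have v: "v \<in> T" if "T \<in> F" for T using assms(1) that by (simp add: sunflower_def)
  have "card (\<Union>T\<in>F. T - {v}) = (\<Sum>T\<in>F. card (T - {v}))"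
    using assms unfolding sunflower_def pairwise_def
    by (intro card_UN_disjoint) (simp_all, blast)
  also have "\<dots> = (k - 1) * card F"
    using assms(4) v by simp
  finally have *: "card (\<Union>T\<in>F. T - {v}) = (k - 1) * card F" .
  have "\<Union>F = insert v (\<Union>T\<in>F. T - {v})" using v assms(3) by auto
  moreover have "card (insert v (\<Union>T\<in>F. T - {v})) = Suc (card (\<Union>T\<in>F. T - {v}))"
    using assms by (intro card_insert_disjoint) auto
  ultimately show ?thesis using * by simp
qed

lemma obtain_maximal_set:
  assumes "finite C" "A \<in> C"
  obtains M where "M \<in> C" "\<forall>B\<in>C. M \<subseteq> B \<longrightarrow> M = B"
  using finite_has_maximal2[OF assms] by (elim bexE conjE)

text \<open>
  In a maximal sunflower, every edge at \<open>v\<close> shares a further vertex with one of its members. There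
  are at most \<open>k - 1\<close> such vertices in each member, and each lies in at most \<open>\<kappa>\<close> of the edges.
\<close>

lemma large_sunflower:
  assumes "finite A" "\<And>T. T \<in> A \<Longrightarrow> finite T \<and> card T = k \<and> v \<in> T" "k \<ge> 1" "\<kappa> \<ge> 1"
    and codeg: "\<And>u. u \<noteq> v \<Longrightarrow> card {T \<in> A. u \<in> T} \<le> \<kappa>"
  obtains F where "F \<subseteq> A" "sunflower v F" "card A \<le> k * \<kappa> * card F"
proof -
  let ?C = "{F. F \<subseteq> A \<and> sunflower v F}"
  have fin: "finite ?C" using assms(1) by (auto intro: finite_subset[of _ "Pow A"])
  have ne: "{} \<in> ?C" by (simp add: sunflower_def)
  obtain F where F: "F \<in> ?C" and max: "\<forall>F'\<in>?C. F \<subseteq> F' \<longrightarrow> F = F'"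
    by (rule obtain_maximal_set[OF fin ne])
  have finF: "finite F" using F assms(1) by (auto intro: finite_subset)
  have "A \<subseteq> F \<union> (\<Union>T\<in>F. \<Union>u\<in>T - {v}. {T' \<in> A. u \<in> T'})"
  proof
    fix T assume T: "T \<in> A"
    show "T \<in> F \<union> (\<Union>T\<in>F. \<Union>u\<in>T - {v}. {T' \<in> A. u \<in> T'})"
    proof (cases "\<exists>T'\<in>F. T' \<inter> T \<noteq> {v}")
      case True
      then obtain T' where "T' \<in> F" "T' \<inter> T \<noteq> {v}" by blast
      moreover have "v \<in> T' \<inter> T" using assms(2) T F \<open>T' \<in> F\<close> by auto
      ultimately obtain u where "u \<in> T'" "u \<in> T" "u \<noteq> v" by auto
      then show ?thesis using T \<open>T' \<in> F\<close> by auto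
    next
      case False
      then have "\<forall>T'\<in>F. T' \<inter> T = {v}" by blast
      then have "pairwise (\<lambda>T T'. T \<inter> T' = {v}) (insert T F)"
        using F by (simp add: sunflower_def pairwise_insert Int_commute)
      then have "insert T F \<in> ?C"
        using F T assms(2)[OF T] by (simp add: sunflower_def)
      from bspec[OF max this] show ?thesis by auto
    qed
  qed
  then have "card A \<le> card (F \<union> (\<Union>T\<in>F. \<Union>u\<in>T - {v}. {T' \<in> A. u \<in> T'}))"
    using finF F assms(1,2) by (intro card_mono) auto
  also have "\<dots> \<le> card F + card (\<Union>T\<in>F. \<Union>u\<in>T - {v}. {T' \<in> A. u \<in> T'})"
    by (rule card_Un_le)
  also have "\<dots> \<le> card F + (\<Sum>T\<in>F. card (\<Union>u\<in>T - {v}. {T' \<in> A. u \<in> T'}))"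
    using finF by (intro add_left_mono card_UN_le)
  also have "\<dots> \<le> card F + (\<Sum>T\<in>F. (k - 1) * \<kappa>)"
  proof (intro add_left_mono sum_mono)
    fix T assume T: "T \<in> F"
    then have fT: "finite T" "card T = k" "v \<in> T" using assms(2) F by auto
    have "card (\<Union>u\<in>T - {v}. {T' \<in> A. u \<in> T'}) \<le> (\<Sum>u\<in>T - {v}. card {T' \<in> A. u \<in> T'})"
      using fT by (intro card_UN_le) auto
    also have "\<dots> \<le> (\<Sum>u\<in>T - {v}. \<kappa>)"
      using codeg by (intro sum_mono) auto
    finally show "card (\<Union>u\<in>T - {v}. {T' \<in> A. u \<in> T'}) \<le> (k - 1) * \<kappa>"
      using fT by simp
  qed
  also have "\<dots> = (1 + (k - 1) * \<kappa>) * card F" by simp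
  also have "\<dots> \<le> k * \<kappa> * card F"
    using assms(3,4) by (intro mult_right_mono) (cases k; simp)+
  finally show ?thesis using that F by blast
qed

definition edges_at :: "'a set set \<Rightarrow> 'a \<Rightarrow> 'a set set" where
  "edges_at H v = {T \<in> H. v \<in> T}"

lemma sum_card_edges_at:
  assumes "finite X" "finite H" "\<And>T. T \<in> H \<Longrightarrow> T \<subseteq> X \<and> card T = k"
  shows "(\<Sum>v\<in>X. card (edges_at H v)) = k * card H"
proof -
  have "(\<Sum>v\<in>X. card (edges_at H v)) = (\<Sum>v\<in>X. \<Sum>T\<in>H. if v \<in> T then 1 else 0)"
    using assms(2) by (intro sum.cong) (auto simp: edges_at_def sum.If_cases Int_def)
  also have "\<dots> = (\<Sum>T\<in>H. \<Sum>v\<in>X. if v \<in> T then 1 else 0)" by (rule sum.swap)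
  also have "\<dots> = (\<Sum>T\<in>H. k)"
  proof (intro sum.cong refl)
    fix T assume "T \<in> H"
    then have "X \<inter> T = T" "card T = k" using assms(3) by auto
    then show "(\<Sum>v\<in>X. if v \<in> T then 1 else 0) = k"
      using assms(1) by (simp add: sum.If_cases Int_def)
  qed
  finally show ?thesis by simp
qed

section \<open>Disjoint sunflowers in a dense hypergraph\<close>

text \<open>
  This is the deterministic core. It is applied to the hypergraph \<open>H\<close> of the edges inside a set \<open>S\<close>,
  with \<open>lam v\<close> the expected degree of \<open>v\<close> and \<open>R\<close> large, so that \<open>S\<close> has many more edges than the
  expected degrees account for. Charge each edge to its vertex of largest degree. Averaging shows
  that at least half of the edges are charged to good vertices, where \<open>4 * k\<close> times the number of edges
  charged to \<open>v\<close> is at least the degree of \<open>v\<close> plus \<open>R * lam v\<close>.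

  Give every good vertex a target \<open>t v\<close> proportional to its degree, and take a maximal set of good
  vertices that carry pairwise disjoint sunflowers of exactly these sizes, built from charged edges.
  By maximality and bounded codegree, at every good vertex at least half of the charged edges meet
  the union \<open>U\<close> of the sunflowers. The petals at \<open>v\<close> consist of vertices of degree at
  most that of \<open>v\<close>, because \<open>v\<close> has the largest degree in each edge charged to it; so the sunflower
  at \<open>v\<close> meets at most about \<open>k * t v\<close> times the degree of \<open>v\<close> many edges, which up to
  factors in \<open>k\<close> and \<open>\<kappa>\<close> is \<open>(t v)\<^sup>2\<close>. Summing over the sunflowers bounds the number of edges.
\<close>

lemma disjoint_sunflower_system:
  fixes lam :: "'a \<Rightarrow> real"
  assumes finS: "finite S" and edge: "\<And>T. T \<in> H \<Longrightarrow> T \<subseteq> S \<and> card T = k"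
    and k: "k \<ge> 1" and \<kappa>: "\<kappa> \<ge> 1"
    and codeg: "\<And>u v. u \<noteq> v \<Longrightarrow> card {T \<in> H. u \<in> T \<and> v \<in> T} \<le> \<kappa>"
    and lam: "\<And>v. v \<in> S \<Longrightarrow> 0 \<le> lam v"
    and R: "0 \<le> R" "R * sum lam S \<le> k * card H"
  obtains V F where "V \<subseteq> S"
    "\<And>v. v \<in> V \<Longrightarrow> F v \<subseteq> H \<and> F v \<noteq> {} \<and> sunflower v (F v) \<and> R * lam v \<le> 32 * k ^ 3 * \<kappa> * card (F v)"
    "disjoint_family_on (\<lambda>v. \<Union>(F v)) V"
    "card H \<le> 32 * k ^ 3 * \<kappa> * (\<Sum>v\<in>V. (card (F v))\<^sup>2)"
proof -
  have finH: "finite H"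
    using edge finS by (auto intro: finite_subset[of H "Pow S"])
  have finT: "finite T" if "T \<in> H" for T
    using edge[OF that] finS by (auto intro: finite_subset)
  define d where "d v = card (edges_at H v)" for v
  have "\<exists>v\<in>T. \<forall>u\<in>T. d u \<le> d v" if "T \<in> H" for T
  proof -
    have "T \<noteq> {}" using edge[OF that] k by auto
    then have "Max (d ` T) \<in> d ` T" using finT[OF that] by simp
    then obtain v where "v \<in> T" "d v = Max (d ` T)" by auto
    then show ?thesis using finT[OF that] by (metis Max_ge finite_imageI imageI)
  qed
  then obtain c where c: "\<And>T. T \<in> H \<Longrightarrow> c T \<in> T" "\<And>T u. T \<in> H \<Longrightarrow> u \<in> T \<Longrightarrow> d u \<le> d (c T)"
    by metis
  define ch where "ch v = {T \<in> H. c T = v}" for v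
  have ch_sub: "ch v \<subseteq> edges_at H v" for v
    using c(1) by (auto simp: ch_def edges_at_def)
  have ch_le: "card (ch v) \<le> d v" for v
    unfolding d_def using ch_sub finH by (intro card_mono) (auto simp: edges_at_def)
  have fin_ch: "finite (ch v)" for v using finH by (simp add: ch_def)
  define Gd where "Gd = {v \<in> S. ch v \<noteq> {} \<and> d v + R * lam v \<le> 4 * k * card (ch v)}"
  have Gd_S: "Gd \<subseteq> S" and finGd: "finite Gd" using finS by (auto simp: Gd_def)

  have "H = (\<Union>v\<in>S. ch v)" using c(1) edge by (fastforce simp: ch_def)
  then have "card H = (\<Sum>v\<in>S. card (ch v))"
    using card_UN_disjoint[OF finS, of ch] fin_ch by (auto simp: ch_def)
  also have "\<dots> = (\<Sum>v\<in>S - Gd. card (ch v)) + (\<Sum>v\<in>Gd. card (ch v))"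
    by (rule sum.subset_diff[OF Gd_S finS])
  finally have split: "card H = (\<Sum>v\<in>S - Gd. card (ch v)) + (\<Sum>v\<in>Gd. card (ch v))" .
  have "4 * k * real (\<Sum>v\<in>S - Gd. card (ch v)) = (\<Sum>v\<in>S - Gd. 4 * k * real (card (ch v)))"
    by (simp add: sum_distrib_left)
  also have "\<dots> \<le> (\<Sum>v\<in>S - Gd. d v + R * lam v)"
  proof (rule sum_mono)
    fix v assume "v \<in> S - Gd"
    then show "4 * k * real (card (ch v)) \<le> d v + R * lam v"
      using lam[of v] R(1) by (cases "ch v = {}") (auto simp: Gd_def)
  qed
  also have "\<dots> \<le> (\<Sum>v\<in>S. d v + R * lam v)"
    using lam R(1) finS by (intro sum_mono2) auto
  also have "\<dots> = real (\<Sum>v\<in>S. d v) + R * sum lam S"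
    by (simp add: sum.distrib sum_distrib_left)
  also have "\<dots> \<le> k * card H + k * card H"
    using R(2) sum_card_edges_at[OF finS finH edge] by (simp add: d_def)
  finally have "real (4 * k * (\<Sum>v\<in>S - Gd. card (ch v))) \<le> real (2 * k * card H)"
    by simp
  then have "k * (4 * (\<Sum>v\<in>S - Gd. card (ch v))) \<le> k * (2 * card H)"
    by (simp only: of_nat_le_iff ac_simps)
  then have half: "card H \<le> 2 * (\<Sum>v\<in>Gd. card (ch v))"
    using split k by simp

  (* P is the loss between the degree of a good vertex and the size of a sunflower in half of
     its charged edges: a factor 4 * k from being good, 2 from the half, k * kappa from the
     sunflower. The target t v is the quotient of the degree by P, rounded up, so that it is
     at least 1 and low degrees lead to sunflowers with a single petal. *)
  define P where "P = 8 * k\<^sup>2 * \<kappa>"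
  have P: "P \<ge> 1" using k \<kappa> by (simp add: P_def)
  define t where "t v = (LEAST m. d v \<le> P * m)" for v
  have dt: "d v \<le> P * t v" for v
  proof -
    have "d v \<le> P * d v" using P by simp
    then show ?thesis unfolding t_def by (rule LeastI)
  qed
  have t_le: "t v \<le> m" if "d v \<le> P * m" for v m
    unfolding t_def using that by (rule Least_le)
  have d_Gd: "d v \<le> 4 * k * card (ch v)" if "v \<in> Gd" for v
  proof -
    have "0 \<le> R * lam v" using that lam R(1) by (simp add: Gd_def)
    then have "real (d v) \<le> real (4 * k * card (ch v))" using that by (simp add: Gd_def)
    then show ?thesis by (simp only: of_nat_le_iff)
  qed
  have t_pos: "t v \<ge> 1" if "v \<in> Gd" for v
  proof -
    have "card (ch v) \<ge> 1" using that fin_ch[of v] by (simp add: Gd_def Suc_le_eq card_gt_0_iff)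
    then have "1 \<le> P * t v" using ch_le[of v] dt[of v] by linarith
    then show ?thesis by (cases "t v") auto
  qed

  define ok where "ok F v \<longleftrightarrow> F v \<subseteq> ch v \<and> card (F v) = t v \<and> sunflower v (F v)" for F v
  define C where "C = {V. V \<subseteq> Gd \<and> (\<exists>F. (\<forall>v\<in>V. ok F v) \<and> disjoint_family_on (\<lambda>v. \<Union>(F v)) V)}"
  have "finite C"
    using finGd by (rule_tac finite_subset[of _ "Pow Gd"]) (auto simp: C_def)
  moreover have "{} \<in> C" by (simp add: C_def disjoint_family_on_def)
  ultimately obtain V where VC: "V \<in> C" and max: "\<forall>V'\<in>C. V \<subseteq> V' \<longrightarrow> V = V'"
    by (rule obtain_maximal_set)
  then obtain F where VG: "V \<subseteq> Gd" and okV: "\<forall>v\<in>V. ok F v"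
    and disj: "disjoint_family_on (\<lambda>v. \<Union>(F v)) V"
    unfolding C_def by auto
  have ok: "ok F v" if "v \<in> V" for v using okV that by (rule bspec)
  have finV: "finite V" using VG finGd by (rule finite_subset)
  have F_ch: "F v \<subseteq> ch v" and F_card: "card (F v) = t v" and F_sun: "sunflower v (F v)" if "v \<in> V" for v
    using ok[OF that] by (auto simp: ok_def)
  have F_H: "F v \<subseteq> H" if "v \<in> V" for v using F_ch[OF that] by (auto simp: ch_def)
  have F_ne: "F v \<noteq> {}" if "v \<in> V" for v using F_card[OF that] t_pos[of v] that VG by auto
  have finF: "finite (F v)" if "v \<in> V" for v using F_H[OF that] finH by (rule finite_subset)
  define U where "U = (\<Union>v\<in>V. \<Union>(F v))"
  have V_U: "v \<in> U" if "v \<in> V" for v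
  proof -
    obtain T where "T \<in> F v" using F_ne[OF \<open>v \<in> V\<close>] by auto
    then show ?thesis using \<open>v \<in> V\<close> F_sun[OF \<open>v \<in> V\<close>] by (auto simp: U_def sunflower_def)
  qed
  have finUF: "finite (\<Union>(F v))" if "v \<in> V" for v
    using finF[OF that] finT[OF subsetD[OF F_H[OF that]]] by (rule finite_Union)
  have finU: "finite U" using finV finUF by (simp add: U_def)

  have blocked: "card (ch v) \<le> 2 * card {T \<in> ch v. T \<inter> U \<noteq> {}}" if v: "v \<in> Gd" for v
  proof (cases "v \<in> U")
    case True
    then have "{T \<in> ch v. T \<inter> U \<noteq> {}} = ch v" using c(1) by (auto simp: ch_def)
    then show ?thesis by simp
  next
    case False
    define A where "A = {T \<in> ch v. T \<inter> U = {}}"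
    have "card (ch v) = card A + card {T \<in> ch v. T \<inter> U \<noteq> {}}"
      unfolding A_def using fin_ch[of v]
      by (subst card_Un_disjoint[symmetric]) (auto intro: arg_cong[where f = card])
    moreover have "2 * card A < card (ch v)"
    proof (rule ccontr)
      assume "\<not> 2 * card A < card (ch v)"
      then have A2: "card (ch v) \<le> 2 * card A" by simp
      have AH: "T \<in> H" "v \<in> T" if "T \<in> A" for T
        using that c(1) by (auto simp: A_def ch_def)
      have "card {T \<in> A. u \<in> T} \<le> \<kappa>" if "u \<noteq> v" for u
      proof -
        have "card {T \<in> A. u \<in> T} \<le> card {T \<in> H. u \<in> T \<and> v \<in> T}"
          using AH finH by (intro card_mono) auto
        then show ?thesis using codeg[OF that] by simp
      qed
      then obtain F0 where F0: "F0 \<subseteq> A" "sunflower v F0" "card A \<le> k * \<kappa> * card F0"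
        using large_sunflower[of A k v \<kappa>] fin_ch[of v] AH finT edge k \<kappa>
        by (auto simp: A_def)
      have "d v \<le> 4 * k * card (ch v)" using d_Gd[OF v] .
      also have "\<dots> \<le> 4 * k * (2 * (k * \<kappa> * card F0))"
        using A2 F0(3) by (intro mult_left_mono) auto
      also have "\<dots> = P * card F0" by (simp add: P_def power2_eq_square)
      finally have "t v \<le> card F0" by (rule t_le)
      then obtain F' where F': "F' \<subseteq> F0" "card F' = t v"
        by (meson obtain_subset_with_card_n)
      have vV: "v \<notin> V" using False V_U by auto
      have "\<Union>F' \<inter> U = {}" using F'(1) F0(1) by (auto simp: A_def)
      then have "disjoint_family_on (\<lambda>u. \<Union>((F(v := F')) u)) (insert v V)"
        using disj vV by (auto simp: disjoint_family_on_def U_def)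
      moreover have "ok (F(v := F')) u" if "u \<in> insert v V" for u
        using that ok[of u] F' F0(1) sunflower_subset[OF F0(2) F'(1)]
        by (cases "u = v") (auto simp: ok_def A_def)
      ultimately have "insert v V \<in> C"
        using VG v unfolding C_def by blast
      then show False using bspec[OF max, of "insert v V"] vV by auto
    qed
    ultimately show ?thesis by simp
  qed

  have "card H \<le> 2 * (\<Sum>v\<in>Gd. card (ch v))" by (rule half)
  also have "\<dots> \<le> 2 * (\<Sum>v\<in>Gd. 2 * card {T \<in> ch v. T \<inter> U \<noteq> {}})"
    by (intro mult_left_mono sum_mono blocked) auto
  also have "\<dots> = 4 * (\<Sum>v\<in>Gd. card {T \<in> ch v. T \<inter> U \<noteq> {}})"
    by (simp add: sum_distrib_left)
  also have "(\<Sum>v\<in>Gd. card {T \<in> ch v. T \<inter> U \<noteq> {}}) = card (\<Union>v\<in>Gd. {T \<in> ch v. T \<inter> U \<noteq> {}})"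
    using finGd finH by (intro card_UN_disjoint[symmetric]) (auto simp: ch_def)
  also have "\<dots> \<le> card (\<Union>u\<in>U. edges_at H u)"
    using finU finH by (intro card_mono) (auto simp: ch_def edges_at_def)
  also have "\<dots> \<le> (\<Sum>u\<in>U. d u)"
    unfolding d_def by (rule card_UN_le[OF finU])
  also have "\<dots> = (\<Sum>v\<in>V. \<Sum>u\<in>\<Union>(F v). d u)"
    unfolding U_def using finV disj finUF
    by (intro sum.UNION_disjoint) (auto simp: disjoint_family_on_def)
  also have "\<dots> \<le> (\<Sum>v\<in>V. k * P * (card (F v))\<^sup>2)"
  proof (rule sum_mono)
    fix v assume v: "v \<in> V"
    have "(\<Sum>u\<in>\<Union>(F v). d u) \<le> (\<Sum>u\<in>\<Union>(F v). d v)"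
      using F_ch[OF v] c(2) by (intro sum_mono) (auto simp: ch_def)
    also have "\<dots> = (1 + (k - 1) * t v) * d v"
    proof -
      have "finite T \<and> card T = k" if "T \<in> F v" for T
        using that F_H[OF v] edge finT by auto
      then show ?thesis
        using card_Union_sunflower[OF F_sun[OF v] finF[OF v] F_ne[OF v]] F_card[OF v] by simp
    qed
    also have "\<dots> \<le> (k * t v) * (P * t v)"
    proof (intro mult_mono dt)
      have "t v \<ge> 1" using t_pos v VG by auto
      then show "1 + (k - 1) * t v \<le> k * t v" using k by (cases k) auto
    qed auto
    finally show "(\<Sum>u\<in>\<Union>(F v). d u) \<le> k * P * (card (F v))\<^sup>2"
      using F_card[OF v] by (simp add: power2_eq_square ac_simps)
  qed
  also have "\<dots> = k * P * (\<Sum>v\<in>V. (card (F v))\<^sup>2)"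
    by (simp add: sum_distrib_left)
  finally have "card H \<le> 4 * (k * P * (\<Sum>v\<in>V. (card (F v))\<^sup>2))" by simp
  also have "\<dots> = 32 * k ^ 3 * \<kappa> * (\<Sum>v\<in>V. (card (F v))\<^sup>2)"
    by (simp add: P_def power2_eq_square power3_eq_cube)
  finally have total: "card H \<le> 32 * k ^ 3 * \<kappa> * (\<Sum>v\<in>V. (card (F v))\<^sup>2)" .

  have light: "R * lam v \<le> 32 * k ^ 3 * \<kappa> * card (F v)" if v: "v \<in> V" for v
  proof -
    have "R * lam v \<le> 4 * k * card (ch v)" using v VG by (auto simp: Gd_def)
    also have "\<dots> \<le> real (4 * k * (P * t v))"
      unfolding of_nat_mult using order_trans[OF ch_le dt] by (simp add: mult_left_mono flip: of_nat_mult)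
    also have "4 * k * (P * t v) = 32 * k ^ 3 * \<kappa> * card (F v)"
      using F_card[OF v] by (simp add: P_def power2_eq_square power3_eq_cube)
    finally show ?thesis by simp
  qed
  show ?thesis
  proof (rule that[OF _ _ disj total])
    show "V \<subseteq> S" using VG Gd_S by auto
  qed (use F_H F_ne F_sun light in auto)
qed

section \<open>The cost of listing all bouquets\<close>

definition uniform_bouquet :: "'a set set \<Rightarrow> nat \<Rightarrow> nat \<Rightarrow> 'a set \<Rightarrow> ('a \<Rightarrow> 'a set set) \<Rightarrow> bool" where
  "uniform_bouquet H n t V F \<longleftrightarrow> finite V \<and> card V = n \<and>
     (\<forall>v\<in>V. F v \<subseteq> H \<and> card (F v) = t \<and> sunflower v (F v)) \<and>
     disjoint_family_on (\<lambda>v. \<Union>(F v)) V"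

text \<open>
  For a random set that contains each vertex with probability \<open>p\<close>, this is the expected number of
  edges at \<open>v\<close> inside the set, given that \<open>v\<close> belongs to it.
\<close>

definition link_weight :: "'a set set \<Rightarrow> nat \<Rightarrow> real \<Rightarrow> 'a \<Rightarrow> real" where
  "link_weight H k p v = real (card (edges_at H v)) * p ^ (k - 1)"

lemma sum_link_weight:
  fixes p :: real
  assumes "finite X" "finite H" "\<And>T. T \<in> H \<Longrightarrow> T \<subseteq> X \<and> card T = k" "k \<ge> 1"
  shows "(\<Sum>v\<in>X. p * link_weight H k p v) = k * card H * p ^ k"
proof -
  have pk: "p * (x * p ^ (k - Suc 0)) = x * p ^ k" for x
    using assms(4) by (cases k) auto
  have "(\<Sum>v\<in>X. p * link_weight H k p v) = real (\<Sum>v\<in>X. card (edges_at H v)) * p ^ k"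
    by (simp add: link_weight_def pk sum_distrib_right)
  then show ?thesis using sum_card_edges_at[OF assms(1-3)] by simp
qed

text \<open>
  The usual estimate of a binomial coefficient, as the constant case of the bound on elementary
  symmetric sums.
\<close>

lemma choose_mult_power_le:
  fixes q :: real
  assumes "t \<ge> 1" "0 \<le> q"
  shows "real (N choose t) * q ^ t \<le> (exp 1 * (N * q) / t) ^ t"
proof -
  have "(\<Sum>V\<in>nsets {..<N} t. \<Prod>v\<in>V. q) = (\<Sum>V\<in>nsets {..<N} t. q ^ t)"
    by (intro sum.cong) (auto simp: nsets_def)
  also have "\<dots> = real (N choose t) * q ^ t"
    by (simp add: card_nsets_eq)
  finally show ?thesis
    using sum_prod_nsets_le[of "{..<N}" "\<lambda>_. q" t] assms by simp
qed

lemma card_Union_bouquet: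
  assumes "uniform_bouquet H n t V F" "t \<ge> 1" "\<And>T. T \<in> H \<Longrightarrow> finite T \<and> card T = k"
  shows "card (\<Union>v\<in>V. \<Union>(F v)) = n * (1 + (k - 1) * t)"
proof -
  have V: "finite V" "card V = n" and disj: "disjoint_family_on (\<lambda>v. \<Union>(F v)) V"
    and F: "\<And>v. v \<in> V \<Longrightarrow> F v \<subseteq> H" "\<And>v. v \<in> V \<Longrightarrow> card (F v) = t" "\<And>v. v \<in> V \<Longrightarrow> sunflower v (F v)"
    using assms(1) by (auto simp: uniform_bouquet_def)
  have fin: "finite (F v)" "F v \<noteq> {}" if "v \<in> V" for v
    using F(2)[OF that] assms(2) by (auto intro: card_ge_0_finite)
  have T: "finite T \<and> card T = k" if "v \<in> V" "T \<in> F v" for v T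
    using assms(3)[OF subsetD[OF F(1)]] that by auto
  have "finite (\<Union>(F v))" if "v \<in> V" for v
    using fin(1)[OF that] T[OF that] by auto
  then have "card (\<Union>v\<in>V. \<Union>(F v)) = (\<Sum>v\<in>V. card (\<Union>(F v)))"
    using V(1) disj by (intro card_UN_disjoint) (auto simp: disjoint_family_on_def)
  also have "\<dots> = (\<Sum>v\<in>V. 1 + (k - 1) * t)"
  proof (rule sum.cong[OF refl])
    fix v assume v: "v \<in> V"
    show "card (\<Union>(F v)) = 1 + (k - 1) * t"
      using card_Union_sunflower[OF F(3)[OF v] fin[OF v] T[OF v]] F(2)[OF v] by simp
  qed
  finally show ?thesis using V(2) by simp
qed

text \<open>
  The union of a bouquet has exactly \<open>n * (1 + (k - 1) * t)\<close> elements, so the cost of all bouquets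
  factors over the centres: each centre \<open>v\<close> contributes \<open>p\<close> times the cost of choosing \<open>t\<close> petals,
  which is at most \<open>(exp 1 * link_weight H k p v / t) ^ t\<close>. As \<open>v\<close> is light compared with \<open>t\<close>, all but
  one of these \<open>t\<close> factors are at most \<open>exp (-4)\<close>; the remaining factor is kept, because
  summing \<open>p * link_weight H k p v\<close> over all \<open>v\<close> gives \<open>k\<close> times the expected number of edges.
  Choosing \<open>n\<close> centres turns this sum into an \<open>n\<close>-th power divided by \<open>n ^ n\<close>. Hence a number \<open>n\<close> of
  centres that is exponentially small in \<open>t\<close> relative to the expected number of edges suffices; with
  \<open>t = 1\<close> this is the case of a matching that is larger than expected.
\<close>

lemma coverable_bouquets:
  fixes p :: real
  assumes finX: "finite X" and edge: "\<And>T. T \<in> H \<Longrightarrow> T \<subseteq> X \<and> card T = k" and k: "k \<ge> 1"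
    and p: "0 \<le> p" and n: "n \<ge> 1" and t: "t \<ge> 1"
    and large: "k * card H * p ^ k * exp (6 - 2 * real t) \<le> n"
  shows "coverable X p (exp (- 2 * real (n * t)))
    {S \<in> Pow X. \<exists>V F. V \<subseteq> S \<and> (\<forall>v\<in>V. link_weight H k p v \<le> t * exp (- 5)) \<and>
       uniform_bouquet {T \<in> H. T \<subseteq> S} n t V F}"
proof -
  have finH: "finite H"
    using edge finX by (auto intro: finite_subset[of H "Pow X"])
  have finT: "finite T" if "T \<in> H" for T
    using edge[OF that] finX by (auto intro: finite_subset)
  define Y where "Y = {v \<in> X. link_weight H k p v \<le> t * exp (- 5)}"
  have finY: "finite Y" using finX by (simp add: Y_def)
  define N where "N v = card (edges_at H v)" for v
  have fin_at: "finite (edges_at H v)" for v using finH by (simp add: edges_at_def)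
  define B where "B V = (\<Pi>\<^sub>E v\<in>V. nsets (edges_at H v) t)" for V
  have finB: "finite (B V)" if "finite V" for V
    unfolding B_def using that fin_at by (intro finite_PiE finite_imp_finite_nsets)
  define J where "J = Sigma (nsets Y n) B"
  have finJ: "finite J"
    unfolding J_def using finY finB
    by (intro finite_SigmaI finite_imp_finite_nsets) (auto simp: nsets_def)
  define u :: "'a set \<times> ('a \<Rightarrow> 'a set set) \<Rightarrow> 'a set" where "u = (\<lambda>(V, F). \<Union>v\<in>V. \<Union>(F v))"
  define m where "m = n * (1 + (k - 1) * t)"
  (* Having a union of full size m is what makes the sunflowers disjoint with disjoint petals. *)
  define I where "I = {i \<in> J. card (u i) = m}"
  have finI: "finite I" using finJ by (simp add: I_def)
  define a where "a v = p * (real (N v choose t) * (p ^ (k - 1)) ^ t)" for v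
  have a0: "0 \<le> a v" for v using p by (simp add: a_def)

  have "(\<Sum>i\<in>I. p ^ card (u i)) = (\<Sum>i\<in>I. p ^ m)" by (simp add: I_def)
  also have "\<dots> \<le> (\<Sum>i\<in>J. p ^ m)"
    using p finJ by (intro sum_mono2) (auto simp: I_def)
  also have "\<dots> = (\<Sum>V\<in>nsets Y n. \<Sum>F\<in>B V. p ^ m)"
    unfolding J_def using finY finB
    by (subst sum.Sigma) (auto simp: nsets_def intro: finite_imp_finite_nsets[unfolded nsets_def])
  also have "\<dots> = (\<Sum>V\<in>nsets Y n. \<Prod>v\<in>V. a v)"
  proof (rule sum.cong[OF refl])
    fix V assume "V \<in> nsets Y n"
    then have V: "finite V" "card V = n" by (auto simp: nsets_def)
    have "card (B V) = (\<Prod>v\<in>V. N v choose t)"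
      using V fin_at by (simp add: B_def card_PiE card_nsets_eq N_def)
    then have cardB: "(\<Sum>F\<in>B V. p ^ m) = (\<Prod>v\<in>V. real (N v choose t)) * p ^ m"
      by simp
    have "p ^ m = (\<Prod>v\<in>V. p ^ (1 + (k - 1) * t))"
      unfolding m_def prod_constant V(2) by (simp only: power_mult[symmetric] mult.commute)
    also have "\<dots> = (\<Prod>v\<in>V. p * (p ^ (k - 1)) ^ t)"
      by (simp only: power_add power_mult power_one_right)
    finally have pm: "p ^ m = (\<Prod>v\<in>V. p * (p ^ (k - 1)) ^ t)" .
    show "(\<Sum>F\<in>B V. p ^ m) = (\<Prod>v\<in>V. a v)"
      unfolding cardB unfolding pm a_def by (simp only: prod.distrib[symmetric] ac_simps)
  qed
  also have "\<dots> \<le> (exp 1 * sum a Y / n) ^ n"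
    using finY a0 n by (intro sum_prod_nsets_le) auto
  also have "\<dots> \<le> exp (- 2 * real t) ^ n"
  proof (rule power_mono)
    have "a v \<le> exp (5 - 4 * real t) * (p * link_weight H k p v)" if v: "v \<in> Y" for v
    proof -
      define l where "l = link_weight H k p v"
      have l: "0 \<le> l" "l \<le> t * exp (- 5)"
        using v p by (auto simp: Y_def l_def link_weight_def)
      have "real (N v choose t) * (p ^ (k - 1)) ^ t \<le> (exp 1 * l / t) ^ t"
        using choose_mult_power_le[OF t, of "p ^ (k - 1)" "N v"] p
        by (simp add: l_def link_weight_def N_def)
      also have "\<dots> = (exp 1 * l / t) * (exp 1 * l / t) ^ (t - 1)"
        using t by (simp add: power_eq_if)
      also have "\<dots> \<le> (exp 1 * l) * exp (- 4) ^ (t - 1)"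
      proof (intro mult_mono power_mono)
        show "exp 1 * l / t \<le> exp 1 * l"
          using l t divide_left_mono[of 1 "real t" "exp 1 * l"] by simp
        have "exp 1 * l / t \<le> exp 1 * (t * exp (- 5)) / t"
          using l t by (intro divide_right_mono mult_left_mono) auto
        also have "\<dots> = exp (- 4)"
          using t by (simp flip: exp_add)
        finally show "exp 1 * l / t \<le> exp (- 4)" .
      qed (use l in auto)
      also have "\<dots> = exp (5 - 4 * real t) * l"
      proof -
        have "exp 1 * exp (- 4) ^ (t - 1) = exp (1 + real (t - 1) * (- 4))"
          by (simp only: exp_add exp_of_nat_mult)
        also have "1 + real (t - 1) * (- 4) = 5 - 4 * real t"
          using t by (simp add: of_nat_diff)
        finally show ?thesis by (simp add: ac_simps)
      qed
      finally have "real (N v choose t) * (p ^ (k - 1)) ^ t \<le> exp (5 - 4 * real t) * l" .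
      from mult_left_mono[OF this p] show ?thesis
        unfolding a_def l_def[symmetric] by (simp only: ac_simps)
    qed
    then have "sum a Y \<le> (\<Sum>v\<in>Y. exp (5 - 4 * real t) * (p * link_weight H k p v))"
      by (rule sum_mono)
    also have "\<dots> \<le> (\<Sum>v\<in>X. exp (5 - 4 * real t) * (p * link_weight H k p v))"
      using finX p by (intro sum_mono2) (auto simp: Y_def link_weight_def)
    also have "\<dots> = exp (5 - 4 * real t) * (k * card H * p ^ k)"
      using sum_link_weight[OF finX finH edge k, of p] by (simp flip: sum_distrib_left)
    finally have "exp 1 * sum a Y \<le> exp 1 * (exp (5 - 4 * real t) * (k * card H * p ^ k))"
      by simp
    also have "\<dots> = exp (- 2 * real t) * (k * card H * p ^ k * exp (6 - 2 * real t))"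
    proof -
      have "exp 1 * exp (5 - 4 * real t) = exp (- 2 * real t) * exp (6 - 2 * real t)"
        by (simp flip: exp_add)
      then show ?thesis by (simp add: ac_simps)
    qed
    also have "\<dots> \<le> exp (- 2 * real t) * n"
      using large by (intro mult_left_mono) auto
    finally show "exp 1 * sum a Y / n \<le> exp (- 2 * real t)"
      using n by (simp add: divide_le_eq)
    show "0 \<le> exp 1 * sum a Y / n"
      using a0 by (simp add: sum_nonneg)
  qed
  also have "\<dots> = exp (- 2 * real (n * t))"
    by (simp add: exp_of_nat_mult[symmetric] ac_simps)
  finally have cost: "(\<Sum>i\<in>I. p ^ card (u i)) \<le> exp (- 2 * real (n * t))" .

  have uX: "u i \<subseteq> X" if "i \<in> I" for i
    using that edge unfolding I_def J_def u_def B_def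
    by (fastforce simp: PiE_iff nsets_def edges_at_def)
  have "coverable X p (exp (- 2 * real (n * t))) {S \<in> Pow X. \<exists>i\<in>I. u i \<subseteq> S}"
    by (rule coverable_image[OF finI p _ cost]) (rule uX)
  then show ?thesis
  proof (rule coverable_mono)
    show "{S \<in> Pow X. \<exists>V F. V \<subseteq> S \<and> (\<forall>v\<in>V. link_weight H k p v \<le> t * exp (- 5)) \<and>
       uniform_bouquet {T \<in> H. T \<subseteq> S} n t V F} \<subseteq> {S \<in> Pow X. \<exists>i\<in>I. u i \<subseteq> S}"
    proof
      fix S assume "S \<in> {S \<in> Pow X. \<exists>V F. V \<subseteq> S \<and> (\<forall>v\<in>V. link_weight H k p v \<le> t * exp (- 5)) \<and>
         uniform_bouquet {T \<in> H. T \<subseteq> S} n t V F}"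
      then obtain V F where S: "S \<subseteq> X" "V \<subseteq> S" and light: "\<forall>v\<in>V. link_weight H k p v \<le> t * exp (- 5)"
        and bouq: "uniform_bouquet {T \<in> H. T \<subseteq> S} n t V F" by auto
      define F' where "F' = restrict F V"
      have uF: "u (V, F') = (\<Union>v\<in>V. \<Union>(F v))" by (simp add: u_def F'_def)
      have "V \<in> nsets Y n"
        using S light bouq by (auto simp: nsets_def Y_def uniform_bouquet_def)
      moreover have "F' \<in> B V"
        unfolding B_def F'_def
      proof (rule restrict_PiE_iff[THEN iffD2], rule ballI)
        fix v assume "v \<in> V"
        then have "F v \<subseteq> {T \<in> H. T \<subseteq> S}" "card (F v) = t" "\<forall>T\<in>F v. v \<in> T"
          using bouq by (auto simp: uniform_bouquet_def sunflower_def)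
        then show "F v \<in> nsets (edges_at H v) t"
          using t by (auto simp: nsets_def edges_at_def intro: card_ge_0_finite)
      qed
      moreover have "card (u (V, F')) = m"
        unfolding uF m_def using card_Union_bouquet[OF bouq t, of k] edge finT by auto
      ultimately have "(V, F') \<in> I" by (simp add: I_def J_def)
      moreover have "u (V, F') \<subseteq> S"
        unfolding uF using bouq by (fastforce simp: uniform_bouquet_def)
      ultimately show "S \<in> {S \<in> Pow X. \<exists>i\<in>I. u i \<subseteq> S}" using S(1) by auto
    qed
  qed (rule order_refl)
qed

section \<open>Sets that contain many more edges than expected\<close>

lemma two_le_exp_1: "(2::real) \<le> exp 1"
  using exp_ge_add_one_self[of 1] by simp

lemma exp_neg_le_half_power: "exp (- real m) \<le> (1/2) ^ m"
proof -
  have "(2::real) ^ m \<le> exp 1 ^ m" using two_le_exp_1 by (intro power_mono) auto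
  also have "exp 1 ^ m = exp (real m)" by (simp flip: exp_of_nat_mult)
  finally have "inverse (exp (real m)) \<le> inverse (2 ^ m)" by (intro le_imp_inverse_le) auto
  then show ?thesis by (simp add: exp_minus power_one_over field_simps)
qed

lemma square_exp_neg_le: "(real t)\<^sup>2 * exp (- 2 * real t) \<le> 4 * (1/2) ^ t"
proof -
  have "real t / 2 \<le> exp (real t / 2)"
    using exp_ge_add_one_self[of "real t / 2"] by linarith
  then have "(real t / 2)\<^sup>2 \<le> (exp (real t / 2))\<^sup>2" by (intro power_mono) auto
  also have "\<dots> = exp (real t)" by (simp flip: exp_of_nat_mult)
  finally have "(real t)\<^sup>2 \<le> 4 * exp (real t)" by (simp add: power_divide)
  then have "(real t)\<^sup>2 * exp (- 2 * real t) \<le> 4 * exp (real t) * exp (- 2 * real t)"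
    by (intro mult_right_mono) auto
  also have "\<dots> = 4 * exp (- real t)" by (simp flip: exp_add)
  also have "\<dots> \<le> 4 * (1/2) ^ t" using exp_neg_le_half_power by simp
  finally show ?thesis .
qed

lemma sum_half_power_le: "(\<Sum>i\<in>{1..m}. (1/2) ^ i) \<le> (1::real)"
proof -
  have "(\<Sum>i\<in>{1..m}. (1/2) ^ i) = 1 - (1/2::real) ^ m"
    by (induction m) (simp_all add: field_simps)
  then show ?thesis by simp
qed

text \<open>
  Half of the exponent yields the factor \<open>exp (- l)\<close>; the other half is at most \<open>1 - n - t\<close>, which
  leaves a product of two geometric sums.
\<close>

lemma sum_exp_product_le:
  "(\<Sum>(n, t)\<in>{(n, t) \<in> {1..a} \<times> {1..b}. l \<le> n * t}. exp (- 2 * real (n * t))) \<le> 3 * exp (- real l)"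
proof -
  have term_le: "exp (- 2 * real (n * t)) \<le> 3 * exp (- real l) * ((1/2) ^ n * (1/2) ^ t)"
    if "1 \<le> n" "1 \<le> t" "l \<le> n * t" for n t
  proof -
    have "0 \<le> (real n - 1) * (real t - 1)" using that by simp
    then have "real n + real t - 1 \<le> real (n * t)" by (simp add: algebra_simps)
    moreover have "real l \<le> real (n * t)" using that(3) by (simp only: of_nat_le_iff)
    ultimately have "exp (- 2 * real (n * t)) \<le> exp (1 + (- real l) + (- real n) + (- real t))"
      by simp
    also have "\<dots> = exp 1 * exp (- real l) * (exp (- real n) * exp (- real t))"
      by (simp only: exp_add ac_simps)
    also have "\<dots> \<le> 3 * exp (- real l) * ((1/2) ^ n * (1/2) ^ t)"
      using exp_le exp_neg_le_half_power by (intro mult_mono) auto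
    finally show ?thesis .
  qed
  have "(\<Sum>(n, t)\<in>{(n, t) \<in> {1..a} \<times> {1..b}. l \<le> n * t}. exp (- 2 * real (n * t)))
      \<le> (\<Sum>(n, t)\<in>{(n, t) \<in> {1..a} \<times> {1..b}. l \<le> n * t}. 3 * exp (- real l) * ((1/2) ^ n * (1/2) ^ t))"
    using term_le by (intro sum_mono) auto
  also have "\<dots> \<le> (\<Sum>(n, t)\<in>{1..a} \<times> {1..b}. 3 * exp (- real l) * ((1/2) ^ n * (1/2) ^ t))"
    by (intro sum_mono2) auto
  also have "\<dots> = 3 * exp (- real l) * ((\<Sum>n\<in>{1..a}. (1/2) ^ n) * (\<Sum>t\<in>{1..b}. (1/2) ^ t))"
    unfolding sum_product unfolding sum.cartesian_product unfolding sum_distrib_left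
    by (auto intro!: sum.cong)
  also have "\<dots> \<le> 3 * exp (- real l) * (1 * 1)"
    using sum_half_power_le by (intro mult_left_mono mult_mono sum_nonneg) auto
  finally show ?thesis by simp
qed

text \<open>
  Let \<open>t v\<close> be the sizes of the disjoint sunflowers found in a set \<open>S\<close> with many edges, and group
  the centres by the value of \<open>t v\<close>. A class is a bouquet, and the cover consists of all bouquets
  that are cheap and have at least \<open>l\<close> petals in total. If no class were of this kind, then the class
  of each \<open>t\<close> would have fewer than a constant times \<open>exp (- 2 * t)\<close> times the expected number of
  edges, or fewer than \<open>l / t\<close> centres; either way \<open>t < l\<close>. The sum of \<open>(t v)\<^sup>2\<close> would then be
  bounded by a constant times the expected number of edges plus \<open>l ^ 3\<close>, which is less than what
  \<open>disjoint_sunflower_system\<close> provides. Requiring \<open>l\<close> petals makes the total cost of the cover small in \<open>l\<close>,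
  so that covers for all levels \<open>l\<close> of a weight function can be afforded at once.
\<close>

lemma coverable_many_edges:
  fixes p :: real
  assumes finX: "finite X" and edge: "\<And>T. T \<in> H \<Longrightarrow> T \<subseteq> X \<and> card T = k"
    and k: "k \<ge> 1" and \<kappa>: "\<kappa> \<ge> 1"
    and codeg: "\<And>u v. u \<noteq> v \<Longrightarrow> card {T \<in> H. u \<in> T \<and> v \<in> T} \<le> \<kappa>"
    and p: "0 \<le> p" and l: "k * card H * p ^ k * exp 6 \<le> exp (2 * real l)"
  defines "\<Theta> \<equiv> real (32 * k ^ 3 * \<kappa>)"
  shows "coverable X p (3 * exp (- real l))
    {S \<in> Pow X. \<Theta> * (4 * exp 6 * (k * card H * p ^ k) + real l ^ 3 +
        exp 5 * (\<Sum>v\<in>S. link_weight H k p v)) < card {T \<in> H. T \<subseteq> S}}"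
proof -
  have finH: "finite H"
    using edge finX by (auto intro: finite_subset[of H "Pow X"])
  define E where "E = k * card H * p ^ k"
  have E: "0 \<le> E" using p by (simp add: E_def)
  define I where "I = {(n, t) \<in> {1..card X} \<times> {1..card H}. l \<le> n * t}"
  define J where "J = {(n, t) \<in> I. E * exp (6 - 2 * real t) \<le> n}"
  have finI: "finite I"
    unfolding I_def by (rule finite_subset[of _ "{1..card X} \<times> {1..card H}"]) auto
  have finJ: "finite J" unfolding J_def using finI by (rule finite_subset[rotated]) auto
  define Fam where "Fam n t = {S \<in> Pow X. \<exists>V F. V \<subseteq> S \<and>
    (\<forall>v\<in>V. link_weight H k p v \<le> real t * exp (- 5)) \<and> uniform_bouquet {T \<in> H. T \<subseteq> S} n t V F}" for n t
  have "coverable X p (\<Sum>i\<in>J. case i of (n, t) \<Rightarrow> exp (- 2 * real (n * t)))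
      (\<Union>i\<in>J. case i of (n, t) \<Rightarrow> Fam n t)"
  proof (rule coverable_UN[OF finX p finJ])
    fix i assume "i \<in> J"
    then obtain n t where i: "i = (n, t)" "1 \<le> n" "1 \<le> t" "E * exp (6 - 2 * real t) \<le> n"
      by (auto simp: J_def I_def)
    show "coverable X p (case i of (n, t) \<Rightarrow> exp (- 2 * real (n * t))) (case i of (n, t) \<Rightarrow> Fam n t)"
      unfolding i(1) prod.case Fam_def
      using coverable_bouquets[OF finX edge k p i(2,3)] i(4) by (simp add: E_def)
  qed
  then show ?thesis
  proof (rule coverable_mono)
    have "(\<Sum>i\<in>J. case i of (n, t) \<Rightarrow> exp (- 2 * real (n * t)))
        \<le> (\<Sum>i\<in>I. case i of (n, t) \<Rightarrow> exp (- 2 * real (n * t)))"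
      using finI by (intro sum_mono2) (auto simp: J_def)
    also have "\<dots> \<le> 3 * exp (- real l)"
      unfolding I_def by (rule sum_exp_product_le)
    finally show "(\<Sum>i\<in>J. case i of (n, t) \<Rightarrow> exp (- 2 * real (n * t))) \<le> 3 * exp (- real l)" .
  next
    show "{S \<in> Pow X. \<Theta> * (4 * exp 6 * (k * card H * p ^ k) + real l ^ 3 +
        exp 5 * (\<Sum>v\<in>S. link_weight H k p v)) < card {T \<in> H. T \<subseteq> S}}
      \<subseteq> (\<Union>i\<in>J. case i of (n, t) \<Rightarrow> Fam n t)"
    proof
      fix S assume "S \<in> {S \<in> Pow X. \<Theta> * (4 * exp 6 * (k * card H * p ^ k) + real l ^ 3 +
        exp 5 * (\<Sum>v\<in>S. link_weight H k p v)) < card {T \<in> H. T \<subseteq> S}}"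
      then have SX: "S \<subseteq> X" and many: "\<Theta> * (4 * exp 6 * E + real l ^ 3 +
        exp 5 * (\<Sum>v\<in>S. link_weight H k p v)) < card {T \<in> H. T \<subseteq> S}"
        by (auto simp: E_def)
      define HS where "HS = {T \<in> H. T \<subseteq> S}"
      have finS: "finite S" using SX finX by (rule finite_subset)
      have finHS: "finite HS" using finH by (simp add: HS_def)
      have \<Theta>: "0 < \<Theta>" using k \<kappa> by (simp add: \<Theta>_def)
      define lam where "lam = link_weight H k p"
      have lam: "0 \<le> lam v" for v using p by (simp add: lam_def link_weight_def)
      have lamS: "0 \<le> sum lam S" using lam by (simp add: sum_nonneg)
      have "\<Theta> * exp 5 * sum lam S \<le> \<Theta> * (4 * exp 6 * E + real l ^ 3 + exp 5 * sum lam S)"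
        using \<Theta> E by (simp add: algebra_simps)
      also have "\<dots> \<le> card HS" using many by (simp add: lam_def HS_def)
      also have "\<dots> \<le> k * card HS"
        using k mult_right_mono[of 1 "real k" "real (card HS)"] by simp
      finally have R: "\<Theta> * exp 5 * sum lam S \<le> k * card HS" .
      have edgeS: "T \<subseteq> S \<and> card T = k" if "T \<in> HS" for T
        using that edge by (auto simp: HS_def)
      have codegS: "card {T \<in> HS. u \<in> T \<and> v \<in> T} \<le> \<kappa>" if "u \<noteq> v" for u v
      proof -
        have "card {T \<in> HS. u \<in> T \<and> v \<in> T} \<le> card {T \<in> H. u \<in> T \<and> v \<in> T}"
          using finH by (intro card_mono) (auto simp: HS_def)
        then show ?thesis using codeg[OF that] by simp
      qed
      have R0: "0 \<le> \<Theta> * exp 5" using \<Theta> by simp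
      obtain V F where VS: "V \<subseteq> S"
        and F: "\<And>v. v \<in> V \<Longrightarrow> F v \<subseteq> HS \<and> F v \<noteq> {} \<and> sunflower v (F v) \<and>
          \<Theta> * exp 5 * lam v \<le> 32 * k ^ 3 * \<kappa> * card (F v)"
        and disj: "disjoint_family_on (\<lambda>v. \<Union>(F v)) V"
        and total: "card HS \<le> 32 * k ^ 3 * \<kappa> * (\<Sum>v\<in>V. (card (F v))\<^sup>2)"
        using disjoint_sunflower_system[OF finS edgeS k \<kappa> codegS lam R0 R] by blast
      have finV: "finite V" using VS finS by (rule finite_subset)
      define t where "t v = card (F v)" for v
      have t_range: "1 \<le> t v \<and> t v \<le> card H" if "v \<in> V" for v
      proof -
        have "finite (F v)" using F[OF that] finHS by (auto intro: finite_subset)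
        moreover have "F v \<subseteq> H" using F[OF that] by (auto simp: HS_def)
        ultimately show ?thesis
          using F[OF that] finH by (auto simp: t_def Suc_le_eq card_gt_0_iff intro: card_mono)
      qed
      have light: "lam v \<le> t v * exp (- 5)" if "v \<in> V" for v
      proof -
        have "\<Theta> * (exp 5 * lam v) \<le> \<Theta> * t v"
          using F[OF that] by (simp add: \<Theta>_def t_def ac_simps)
        then have "exp 5 * lam v \<le> t v" using \<Theta> by simp
        then show ?thesis by (simp add: exp_minus field_simps)
      qed
      define W where "W m = {v \<in> V. t v = m}" for m
      have bouquet: "uniform_bouquet HS (card (W m)) m (W m) F" for m
        using F finV disjoint_family_on_mono[OF _ disj, of "W m"]
        by (auto simp: uniform_bouquet_def W_def t_def)
      have "\<exists>m\<ge>1. W m \<noteq> {} \<and> E * exp (6 - 2 * real m) \<le> card (W m) \<and> l \<le> card (W m) * m"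
      proof (rule ccontr)
        assume none: "\<not> ?thesis"
        have small: "m < l \<and> real (card (W m)) * (real m)\<^sup>2 \<le> 4 * exp 6 * E * (1/2) ^ m + real l ^ 2"
          if m: "m \<ge> 1" "W m \<noteq> {}" for m
        proof -
          have n1: "card (W m) \<ge> 1"
            using m(2) finV by (simp add: W_def Suc_le_eq card_gt_0_iff)
          consider "card (W m) < E * exp (6 - 2 * real m)" | "card (W m) * m < l"
            using none m by force
          then show ?thesis
          proof cases
            case 1
            have "1 < E * exp (6 - 2 * real m)" using 1 n1 by linarith
            also have "\<dots> = E * exp 6 * exp (- 2 * real m)"
              by (simp add: exp_add[symmetric])
            also have "\<dots> \<le> exp (2 * real l) * exp (- 2 * real m)"
              using l by (intro mult_right_mono) (simp_all add: E_def)
            also have "\<dots> = exp (2 * real l - 2 * real m)" by (simp flip: exp_add)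
            finally have "m < l" by simp
            have "real (card (W m)) * (real m)\<^sup>2 \<le> E * exp (6 - 2 * real m) * (real m)\<^sup>2"
              using 1 by (intro mult_right_mono) auto
            also have "\<dots> = exp 6 * E * ((real m)\<^sup>2 * exp (- 2 * real m))"
              by (simp add: exp_diff exp_minus field_simps)
            also have "\<dots> \<le> exp 6 * E * (4 * (1/2) ^ m)"
              using E by (intro mult_left_mono square_exp_neg_le) auto
            finally have "real (card (W m)) * (real m)\<^sup>2 \<le> 4 * exp 6 * E * (1/2) ^ m" by simp
            moreover have "0 \<le> real l ^ 2" by simp
            ultimately show ?thesis using \<open>m < l\<close> by linarith
          next
            case 2
            have "m \<le> card (W m) * m" using n1 by simp
            then have "m < l" using 2 by linarith
            have "card (W m) * m * m \<le> l * l"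
              using 2 \<open>m < l\<close> by (intro mult_mono) auto
            then have "real (card (W m) * m * m) \<le> real (l * l)" by (simp only: of_nat_le_iff)
            then have "real (card (W m)) * (real m)\<^sup>2 \<le> real l ^ 2"
              by (simp add: power2_eq_square ac_simps)
            moreover have "0 \<le> 4 * exp 6 * E * (1/2) ^ m" using E by simp
            ultimately show ?thesis using \<open>m < l\<close> by linarith
          qed
        qed
        have "t ` V \<subseteq> {1..l}"
        proof
          fix m assume "m \<in> t ` V"
          then have "W m \<noteq> {}" "m \<ge> 1" using t_range by (auto simp: W_def)
          then show "m \<in> {1..l}" using small[of m] by auto
        qed
        then have "(\<Sum>m\<in>{1..l}. \<Sum>v\<in>W m. (real (t v))\<^sup>2) = (\<Sum>v\<in>V. (real (t v))\<^sup>2)"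
          unfolding W_def using finV by (intro sum.group) auto
        then have "(\<Sum>v\<in>V. (real (t v))\<^sup>2) = (\<Sum>m\<in>{1..l}. \<Sum>v\<in>W m. (real (t v))\<^sup>2)" by simp
        also have "\<dots> \<le> (\<Sum>m\<in>{1..l}. 4 * exp 6 * E * (1/2) ^ m + real l ^ 2)"
        proof (rule sum_mono)
          fix m assume m: "m \<in> {1..l}"
          show "(\<Sum>v\<in>W m. (real (t v))\<^sup>2) \<le> 4 * exp 6 * E * (1/2) ^ m + real l ^ 2"
          proof (cases "W m = {}")
            case True
            then show ?thesis using E by simp
          next
            case False
            have "(\<Sum>v\<in>W m. (real (t v))\<^sup>2) = real (card (W m)) * (real m)\<^sup>2"
              by (simp add: W_def)
            then show ?thesis using small[OF _ False] m by simp
          qed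
        qed
        also have "\<dots> = 4 * exp 6 * E * (\<Sum>m\<in>{1..l}. (1/2) ^ m) + real l ^ 3"
          by (simp add: sum.distrib sum_distrib_left power2_eq_square power3_eq_cube)
        also have "\<dots> \<le> 4 * exp 6 * E * 1 + real l ^ 3"
          using E by (intro add_right_mono mult_left_mono sum_half_power_le) auto
        finally have "(\<Sum>v\<in>V. (real (t v))\<^sup>2) \<le> 4 * exp 6 * E + real l ^ 3" by simp
        then have "\<Theta> * (\<Sum>v\<in>V. (real (t v))\<^sup>2) \<le> \<Theta> * (4 * exp 6 * E + real l ^ 3)"
          using \<Theta> by (intro mult_left_mono) auto
        also have "\<dots> \<le> \<Theta> * (4 * exp 6 * E + real l ^ 3 + exp 5 * sum lam S)"
          using \<Theta> lamS by (intro mult_left_mono) auto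
        also have "\<dots> < card HS" using many by (simp add: lam_def HS_def)
        also have "\<dots> \<le> real (32 * k ^ 3 * \<kappa> * (\<Sum>v\<in>V. (card (F v))\<^sup>2))"
          using total by (simp only: of_nat_le_iff)
        also have "\<dots> = \<Theta> * (\<Sum>v\<in>V. (real (t v))\<^sup>2)"
          by (simp add: \<Theta>_def t_def)
        finally show False by simp
      qed
      then obtain m where m: "m \<ge> 1" "W m \<noteq> {}" "E * exp (6 - 2 * real m) \<le> card (W m)" "l \<le> card (W m) * m"
        by auto
      have "1 \<le> card (W m)"
        using m(2) finV by (simp add: W_def Suc_le_eq card_gt_0_iff)
      moreover have "card (W m) \<le> card X"
        using VS SX finX by (intro card_mono) (auto simp: W_def)
      moreover have "m \<le> card H" using m(2) t_range by (auto simp: W_def)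
      ultimately have "(card (W m), m) \<in> J" using m by (simp add: J_def I_def)
      moreover have "S \<in> Fam (card (W m)) m"
        unfolding Fam_def
      proof (intro CollectI conjI exI)
        show "S \<in> Pow X" using SX by simp
        show "W m \<subseteq> S" using VS by (auto simp: W_def)
        show "\<forall>v\<in>W m. link_weight H k p v \<le> real m * exp (- 5)"
          using light by (auto simp: W_def lam_def)
        show "uniform_bouquet {T \<in> H. T \<subseteq> S} (card (W m)) m (W m) F"
          using bouquet by (simp add: HS_def)
      qed
      ultimately show "S \<in> (\<Union>i\<in>J. case i of (n, t) \<Rightarrow> Fam n t)" by (intro UN_I[of "(card (W m), m)"]) auto
    qed
  qed
qed

section \<open>Dyadic levels of a weight function\<close>

definition dyadic :: "('b \<Rightarrow> real) \<Rightarrow> nat \<Rightarrow> 'b set \<Rightarrow> 'b set" where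
  "dyadic h l Y = {y \<in> Y. 1 / 2 ^ (l + 1) < h y \<and> h y \<le> 1 / 2 ^ l}"

lemma finite_dyadic: "finite Y \<Longrightarrow> finite (dyadic h l Y)"
  by (simp add: dyadic_def)

lemma ex_dyadic_level:
  fixes x :: real
  assumes "0 < x" "x \<le> 1 / 2 ^ a"
  shows "\<exists>l\<ge>a. 1 / 2 ^ (l + 1) < x \<and> x \<le> 1 / 2 ^ l"
proof -
  define m where "m = (LEAST m. (1/2) ^ m < x)"
  have ex: "\<exists>m. (1/2) ^ m < x" using real_arch_pow_inv[OF assms(1), of "1/2"] by simp
  have m: "(1/2) ^ m < x" unfolding m_def by (rule LeastI_ex[OF ex])
  have "a < m"
  proof (rule ccontr)
    assume "\<not> a < m"
    then have "(1/2::real) ^ a \<le> (1/2) ^ m" by (intro power_decreasing) auto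
    then show False using m assms(2) by (simp add: power_one_over)
  qed
  then obtain l where l: "m = Suc l" "a \<le> l" by (cases m) auto
  have "\<not> (1/2) ^ l < x" using not_less_Least[of l "\<lambda>m. (1/2) ^ m < x"] l(1) by (simp add: m_def)
  then show ?thesis using m l by (intro exI[of _ l]) (auto simp: power_one_over not_less)
qed

lemma disjoint_dyadic:
  assumes "l \<noteq> l'"
  shows "dyadic h l Y \<inter> dyadic h l' Y = {}"
proof -
  have "False" if "y \<in> dyadic h l Y" "y \<in> dyadic h l' Y" "l < l'" for y l l'
  proof -
    have "(1/2::real) ^ l' \<le> (1/2) ^ (l + 1)" using that(3) by (intro power_decreasing) auto
    moreover have "1 / 2 ^ (l + 1) < h y" "h y \<le> 1 / 2 ^ l'" using that by (auto simp: dyadic_def)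
    ultimately show False by (simp add: power_one_over)
  qed
  then show ?thesis using assms by (metis disjoint_iff linorder_neqE_nat)
qed

text \<open>
  The range of levels depends only on \<open>Y\<close>, so that a single finite family of covers, one for each
  level, serves all subsets \<open>Z\<close>.
\<close>

lemma sum_le_sum_dyadic:
  assumes "finite Y" "\<And>y. y \<in> Y \<Longrightarrow> 0 \<le> h y"
  obtains m where "\<forall>Z\<subseteq>Y. (\<forall>y\<in>Z. h y \<le> 1 / 2 ^ a) \<longrightarrow>
    sum h Z \<le> (\<Sum>l\<in>{a..<m}. card (dyadic h l Z) / 2 ^ l)"
proof -
  define Y' where "Y' = {y \<in> Y. 0 < h y \<and> h y \<le> 1 / 2 ^ a}"
  have "\<forall>y\<in>Y'. \<exists>l\<ge>a. 1 / 2 ^ (l + 1) < h y \<and> h y \<le> 1 / 2 ^ l"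
    using ex_dyadic_level by (auto simp: Y'_def)
  then obtain lv where lv: "\<forall>y\<in>Y'. lv y \<ge> a \<and> 1 / 2 ^ (lv y + 1) < h y \<and> h y \<le> 1 / 2 ^ lv y"
    by metis
  define m where "m = Suc (Max (lv ` Y'))"
  have finY': "finite Y'" using assms(1) by (simp add: Y'_def)
  have lv_m: "lv y < m" if "y \<in> Y'" for y
    unfolding m_def using finY' that by (simp add: less_Suc_eq_le)
  show ?thesis
  proof (rule that, intro allI impI)
    fix Z assume Z: "Z \<subseteq> Y" "\<forall>y\<in>Z. h y \<le> 1 / 2 ^ a"
    have finZ: "finite Z" using Z(1) assms(1) by (rule finite_subset)
    have sub: "{y \<in> Z. h y \<noteq> 0} \<subseteq> (\<Union>l\<in>{a..<m}. dyadic h l Z)"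
    proof
      fix y assume y: "y \<in> {y \<in> Z. h y \<noteq> 0}"
      then have "y \<in> Y'" using Z assms(2)[of y] by (auto simp: Y'_def)
      then show "y \<in> (\<Union>l\<in>{a..<m}. dyadic h l Z)"
        using lv lv_m[of y] y by (auto simp: dyadic_def intro!: bexI[of _ "lv y"])
    qed
    have "sum h Z = sum h {y \<in> Z. h y \<noteq> 0}"
      using finZ by (intro sum.mono_neutral_right) auto
    also have "\<dots> \<le> sum h (\<Union>l\<in>{a..<m}. dyadic h l Z)"
      using sub finZ Z(1) assms(2) by (intro sum_mono2 finite_UN_I finite_dyadic) (auto simp: dyadic_def)
    also have "\<dots> = (\<Sum>l\<in>{a..<m}. sum h (dyadic h l Z))"
      using finZ by (intro sum.UNION_disjoint ballI impI disjoint_dyadic) (auto simp: finite_dyadic)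
    also have "\<dots> \<le> (\<Sum>l\<in>{a..<m}. card (dyadic h l Z) / 2 ^ l)"
    proof (rule sum_mono)
      fix l
      have "sum h (dyadic h l Z) \<le> of_nat (card (dyadic h l Z)) * (1 / 2 ^ l)"
        by (rule sum_bounded_above) (simp add: dyadic_def)
      then show "sum h (dyadic h l Z) \<le> card (dyadic h l Z) / 2 ^ l" by simp
    qed
    finally show "sum h Z \<le> (\<Sum>l\<in>{a..<m}. card (dyadic h l Z) / 2 ^ l)" .
  qed
qed

lemma sum_dyadic_le:
  assumes "finite Y" "\<And>y. y \<in> Y \<Longrightarrow> 0 \<le> h y" "finite L"
  shows "(\<Sum>l\<in>L. card (dyadic h l Y) / 2 ^ l) \<le> 2 * sum h Y"
proof -
  have "(\<Sum>l\<in>L. card (dyadic h l Y) / 2 ^ l) \<le> (\<Sum>l\<in>L. \<Sum>y\<in>dyadic h l Y. 2 * h y)"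
  proof (rule sum_mono)
    fix l
    have "of_nat (card (dyadic h l Y)) * (1 / 2 ^ l) \<le> (\<Sum>y\<in>dyadic h l Y. 2 * h y)"
      by (rule sum_bounded_below) (simp add: dyadic_def field_simps)
    then show "card (dyadic h l Y) / 2 ^ l \<le> (\<Sum>y\<in>dyadic h l Y. 2 * h y)" by simp
  qed
  also have "\<dots> = (\<Sum>y\<in>(\<Union>l\<in>L. dyadic h l Y). 2 * h y)"
    using assms(1,3)
    by (intro sum.UNION_disjoint[symmetric] ballI impI disjoint_dyadic) (auto simp: finite_dyadic)
  also have "\<dots> \<le> (\<Sum>y\<in>Y. 2 * h y)"
    using assms(1,2) by (intro sum_mono2) (auto simp: dyadic_def)
  finally show ?thesis by (simp add: sum_distrib_left)
qed

lemma sum_power_le: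
  fixes q :: real
  assumes "0 \<le> q" "q < 1"
  shows "(\<Sum>i\<in>{a..<m}. q ^ i) \<le> q ^ a / (1 - q)"
proof -
  have "(1 - q) * (\<Sum>i\<in>{a..<m}. q ^ i) \<le> q ^ a"
  proof (cases "a \<le> m")
    case True
    then have "(1 - q) * (\<Sum>i\<in>{a..<m}. q ^ i) = q ^ a - q ^ m"
    proof (induction m rule: nat_induct_at_least)
      case (Suc n)
      then show ?case by (simp add: distrib_left) (simp add: algebra_simps)
    qed simp
    then show ?thesis using assms by simp
  qed (use assms in simp)
  then show ?thesis using assms by (simp add: field_simps)
qed

lemma sum_index_over_power: "(\<Sum>i\<in>{6..<m}. real i / 2 ^ i) \<le> 7 / 32"
proof (cases "6 \<le> m")
  case True
  then have "(\<Sum>i\<in>{6..<m}. real i / 2 ^ i) = 7 / 32 - 2 * (real m + 1) / 2 ^ m"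
  proof (induction m rule: nat_induct_at_least)
    case (Suc n)
    then have "(\<Sum>i\<in>{6..<Suc n}. real i / 2 ^ i) =
        7 / 32 - 2 * (real n + 1) / 2 ^ n + real n / 2 ^ n" by simp
    also have "\<dots> = 7 / 32 - 2 * (real (Suc n) + 1) / 2 ^ Suc n"
      by (simp add: field_simps)
    finally show ?case .
  qed simp
  then show ?thesis by simp
qed simp

lemma sum_cube_over_power:
  assumes "7 \<le> a"
  shows "(\<Sum>l\<in>{a..<m}. real l ^ 3 / 2 ^ l) \<le> 128 * (3/4) ^ a"
proof -
  have cube: "real l ^ 3 \<le> 32 * (3/2) ^ l" if "7 \<le> l" for l
    using that
  proof (induction l rule: nat_induct_at_least)
    case base
    show ?case by (simp add: power_divide)
  next
    case (Suc l)
    have "(real l + 1) ^ 3 = real l ^ 3 + 3 * real l ^ 2 + 3 * real l + 1"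
      by (simp add: power3_eq_cube power2_eq_square algebra_simps)
    also have "\<dots> \<le> real l ^ 3 + real l ^ 3 / 2"
    proof -
      have l: "7 \<le> real l" using Suc by simp
      have "7 * (real l * real l) \<le> real l * (real l * real l)"
        using l by (intro mult_right_mono) auto
      moreover have "7 * real l \<le> real l * real l" using l by (intro mult_right_mono) auto
      ultimately have "6 * (real l * real l) + 6 * real l + 2 \<le> real l * (real l * real l)"
        using l by linarith
      then show ?thesis by (simp add: power3_eq_cube power2_eq_square)
    qed
    also have "\<dots> \<le> 32 * (3/2) ^ Suc l" using Suc.IH by simp
    finally show ?case by (simp add: add.commute)
  qed
  have "(\<Sum>l\<in>{a..<m}. real l ^ 3 / 2 ^ l) \<le> (\<Sum>l\<in>{a..<m}. 32 * (3/4) ^ l)"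
  proof (rule sum_mono)
    fix l assume "l \<in> {a..<m}"
    then have "real l ^ 3 / 2 ^ l \<le> 32 * (3/2) ^ l / 2 ^ l"
      using cube assms by (intro divide_right_mono) auto
    also have "\<dots> = 32 * ((3/2) / 2) ^ l"
      by (simp only: power_divide times_divide_eq_right)
    finally show "real l ^ 3 / 2 ^ l \<le> 32 * (3/4) ^ l" by simp
  qed
  also have "\<dots> = 32 * (\<Sum>l\<in>{a..<m}. (3/4) ^ l)" by (simp add: sum_distrib_left)
  also have "\<dots> \<le> 32 * ((3/4) ^ a / (1 - 3/4))"
    by (intro mult_left_mono sum_power_le) auto
  finally show ?thesis by simp
qed

section \<open>Weighted points\<close>

text \<open>
  This is the analogue of the whole theorem for weights on single points. Points of weight above
  \<open>1 / 2 ^ 6\<close> are listed one by one. For the level of weight about \<open>1 / 2 ^ i\<close> the cover lists all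
  subsets with \<open>n i\<close> points, where \<open>n i\<close> is a constant times the expected number of points of this
  level, plus \<open>i\<close>. The first term makes the list cheap, the second makes its cost exponentially small
  in \<open>i\<close>, and yet the points that can be left over, fewer than \<open>n i\<close> on each level, have a total
  weight below 1.
\<close>

lemma coverable_heavy_points:
  fixes h :: "'a \<Rightarrow> real"
  assumes finX: "finite X" and p: "0 \<le> p" and h: "\<And>v. v \<in> X \<Longrightarrow> 0 \<le> h v"
    and weight: "(\<Sum>v\<in>X. p * h v) \<le> 1 / 1000"
  shows "coverable X p (1/8) {S \<in> Pow X. 1 \<le> sum h S}"
proof -
  obtain m where m: "\<forall>Z\<subseteq>X. (\<forall>v\<in>Z. h v \<le> 1 / 2 ^ 6) \<longrightarrow>
      sum h Z \<le> (\<Sum>i\<in>{6..<m}. card (dyadic h i Z) / 2 ^ i)"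
    by (rule sum_le_sum_dyadic[where Y = X and h = h and a = 6, OF finX h])
  define D where "D i = dyadic h i X" for i
  have finD: "finite (D i)" for i using finX by (simp add: D_def finite_dyadic)
  define c where "c i = exp 2 * (card (D i) * p) + real i" for i
  define n where "n i = nat \<lceil>c i\<rceil>" for i
  have c0: "real i \<le> c i" for i using p by (simp add: c_def)
  have n_ge: "c i \<le> n i" for i
    unfolding n_def by (rule real_nat_ceiling_ge)
  have n_le: "real (n i) < c i + 1" for i
    unfolding n_def using c0[of i] by linarith
  define Big where "Big = {v \<in> X. 1 / 2 ^ 6 < h v}"
  have "coverable X p (64 / 1000) {S \<in> Pow X. \<exists>v\<in>Big. {v} \<subseteq> S}"
  proof (rule coverable_image[OF _ p])
    have "(\<Sum>v\<in>Big. p ^ card {v}) \<le> (\<Sum>v\<in>Big. 64 * (p * h v))"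
    proof (rule sum_mono)
      fix v assume "v \<in> Big"
      then have "p * 1 \<le> p * (64 * h v)" using p by (intro mult_left_mono) (auto simp: Big_def)
      then show "p ^ card {v} \<le> 64 * (p * h v)" by simp
    qed
    also have "\<dots> \<le> (\<Sum>v\<in>X. 64 * (p * h v))"
      using finX h p by (intro sum_mono2) (auto simp: Big_def)
    also have "\<dots> \<le> 64 / 1000" using weight by (simp flip: sum_distrib_left)
    finally show "(\<Sum>v\<in>Big. p ^ card {v}) \<le> 64 / 1000" .
  qed (use finX in \<open>auto simp: Big_def\<close>)
  moreover have "coverable X p (\<Sum>i\<in>{6..<m}. (1/2) ^ i)
      (\<Union>i\<in>{6..<m}. {S \<in> Pow X. \<exists>V\<in>nsets (D i) (n i). V \<subseteq> S})"
  proof (rule coverable_UN[OF finX p finite_atLeastLessThan])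
    fix i assume i: "i \<in> {6..<m}"
    then have n1: "1 \<le> n i" "i \<le> n i" using c0[of i] n_ge[of i] by auto
    have "(\<Sum>V\<in>nsets (D i) (n i). p ^ card V) = (\<Sum>V\<in>nsets (D i) (n i). \<Prod>v\<in>V. p)"
      by simp
    also have "\<dots> \<le> (exp 1 * sum (\<lambda>_. p) (D i) / n i) ^ n i"
      using finD p n1(1) by (intro sum_prod_nsets_le) auto
    also have "\<dots> \<le> exp (- 1) ^ n i"
    proof (rule power_mono)
      have "exp 1 * sum (\<lambda>_. p) (D i) = exp (- 1) * (exp 2 * (card (D i) * p))"
        by (simp add: mult_exp_exp flip: mult.assoc)
      also have "\<dots> \<le> exp (- 1) * n i"
        using n_ge[of i] c0[of i] by (intro mult_left_mono) (auto simp: c_def)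
      finally show "exp 1 * sum (\<lambda>_. p) (D i) / n i \<le> exp (- 1)"
        using n1 by (simp add: divide_le_eq)
    qed (use p in \<open>simp add: sum_nonneg\<close>)
    also have "\<dots> = exp (- real (n i))" by (simp flip: exp_of_nat_mult)
    also have "\<dots> \<le> exp (- real i)" using n1 by simp
    also have "\<dots> \<le> (1/2) ^ i" by (rule exp_neg_le_half_power)
    finally have "(\<Sum>V\<in>nsets (D i) (n i). p ^ card V) \<le> (1/2) ^ i" .
    then show "coverable X p ((1/2) ^ i) {S \<in> Pow X. \<exists>V\<in>nsets (D i) (n i). V \<subseteq> S}"
      using finD by (intro coverable_image[OF _ p] finite_imp_finite_nsets)
        (auto simp: nsets_def D_def dyadic_def)
  qed
  ultimately have "coverable X p (64 / 1000 + (\<Sum>i\<in>{6..<m}. (1/2) ^ i))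
      ({S \<in> Pow X. \<exists>v\<in>Big. {v} \<subseteq> S} \<union>
       (\<Union>i\<in>{6..<m}. {S \<in> Pow X. \<exists>V\<in>nsets (D i) (n i). V \<subseteq> S}))"
    by (rule coverable_Un[OF finX p])
  then show ?thesis
  proof (rule coverable_mono)
    have "(\<Sum>i\<in>{6..<m}. (1/2) ^ i) \<le> (1/2::real) ^ 6 / (1 - 1/2)"
      by (rule sum_power_le) auto
    also have "\<dots> = 1 / 32" by (simp add: power_one_over)
    finally show "64 / 1000 + (\<Sum>i\<in>{6..<m}. (1/2) ^ i) \<le> (1/8::real)" by simp
  next
    show "{S \<in> Pow X. 1 \<le> sum h S} \<subseteq> {S \<in> Pow X. \<exists>v\<in>Big. {v} \<subseteq> S} \<union>
       (\<Union>i\<in>{6..<m}. {S \<in> Pow X. \<exists>V\<in>nsets (D i) (n i). V \<subseteq> S})"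
    proof (rule subsetI, rule ccontr)
      fix S assume "S \<in> {S \<in> Pow X. 1 \<le> sum h S}"
        and "S \<notin> {S \<in> Pow X. \<exists>v\<in>Big. {v} \<subseteq> S} \<union>
          (\<Union>i\<in>{6..<m}. {S \<in> Pow X. \<exists>V\<in>nsets (D i) (n i). V \<subseteq> S})"
      then have S: "S \<subseteq> X" "1 \<le> sum h S" "\<forall>v\<in>S. v \<notin> Big"
        and none: "\<And>i V. i \<in> {6..<m} \<Longrightarrow> V \<in> nsets (D i) (n i) \<Longrightarrow> \<not> V \<subseteq> S"
        by auto
      have few: "card (dyadic h i S) \<le> c i" if i: "i \<in> {6..<m}" for i
      proof -
        have "card (dyadic h i S) < n i"
        proof (rule ccontr)
          assume "\<not> card (dyadic h i S) < n i"
          then obtain V where V: "V \<subseteq> dyadic h i S" "card V = n i"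
            by (meson not_less obtain_subset_with_card_n)
          then have "V \<subseteq> D i" using S(1) by (auto simp: D_def dyadic_def)
          then have "V \<in> nsets (D i) (n i)"
            using V(2) finD[of i] by (auto simp: nsets_def intro: finite_subset)
          moreover have "V \<subseteq> S" using V(1) by (auto simp: dyadic_def)
          ultimately show False using none[OF i] by auto
        qed
        then show ?thesis using n_le[of i] by linarith
      qed
      have "sum h S \<le> (\<Sum>i\<in>{6..<m}. card (dyadic h i S) / 2 ^ i)"
        using S by (intro m[rule_format]) (auto simp: Big_def not_less)
      also have "\<dots> \<le> (\<Sum>i\<in>{6..<m}. c i / 2 ^ i)"
        using few by (intro sum_mono divide_right_mono) auto
      also have "\<dots> = exp 2 * p * (\<Sum>i\<in>{6..<m}. card (D i) / 2 ^ i) + (\<Sum>i\<in>{6..<m}. real i / 2 ^ i)"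
        by (simp add: c_def add_divide_distrib sum.distrib sum_distrib_left ac_simps)
      also have "\<dots> \<le> exp 2 * p * (2 * sum h X) + 7 / 32"
        unfolding D_def using finX h p
        by (intro add_mono mult_left_mono sum_dyadic_le sum_index_over_power) auto
      also have "\<dots> = 2 * exp 2 * (\<Sum>v\<in>X. p * h v) + 7 / 32"
        by (simp flip: sum_distrib_left)
      also have "\<dots> \<le> 2 * 9 * (1 / 1000) + 7 / 32"
      proof -
        have "exp (2::real) = (exp 1)\<^sup>2" by (simp flip: exp_of_nat_mult)
        also have "\<dots> \<le> (3::real)\<^sup>2" using exp_le by (intro power_mono) auto
        finally have "exp (2::real) \<le> 9" by simp
        then show ?thesis using weight h p
          by (intro add_mono mult_mono sum_nonneg) auto
      qed
      also have "\<dots> < 1" by simp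
      finally show False using S(2) by simp
    qed
  qed
qed

section \<open>Weighted uniform hypergraphs of bounded codegree\<close>

lemma exp_le_power_3: "exp (real n) \<le> 3 ^ n"
proof -
  have "exp 1 ^ n \<le> (3::real) ^ n" using exp_le by (intro power_mono) auto
  then show ?thesis by (simp flip: exp_of_nat_mult)
qed

lemma sum_weighted_degrees:
  fixes g :: "'a set \<Rightarrow> real"
  assumes "finite X" "finite H" "\<And>T. T \<in> H \<Longrightarrow> T \<subseteq> X \<and> card T = k"
  shows "(\<Sum>v\<in>X. \<Sum>T\<in>edges_at H v. g T) = k * sum g H"
proof -
  have "(\<Sum>v\<in>X. \<Sum>T\<in>edges_at H v. g T) = (\<Sum>v\<in>X. \<Sum>T\<in>H. if v \<in> T then g T else 0)"
    using assms(2) by (simp add: edges_at_def sum.inter_filter)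
  also have "\<dots> = (\<Sum>T\<in>H. \<Sum>v\<in>X. if v \<in> T then g T else 0)" by (rule sum.swap)
  also have "\<dots> = (\<Sum>T\<in>H. k * g T)"
  proof (intro sum.cong refl)
    fix T assume "T \<in> H"
    then have T: "{v \<in> X. v \<in> T} = T" "card T = k" using assms(3) by auto
    have "(\<Sum>v\<in>X. if v \<in> T then g T else 0) = sum (\<lambda>_. g T) {v \<in> X. v \<in> T}"
      by (rule sum.inter_filter[OF assms(1), symmetric])
    then show "(\<Sum>v\<in>X. if v \<in> T then g T else 0) = k * g T"
      using T by simp
  qed
  finally show ?thesis by (simp add: sum_distrib_left)
qed

text \<open>
  The weight bound is exponentially small in \<open>k\<close>, whereas all losses are polynomial in \<open>k\<close>.
  A set \<open>S\<close> of weight at least 1 is covered for one of three reasons: it contains an edge of weight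
  above \<open>1 / 2 ^ (40 * k)\<close>; or its vertices have large total expected degree, so that it is a heavy
  set for the weighted points \<open>h\<close>; or on some dyadic level \<open>l \<ge> 40 * k\<close> it contains more edges
  than the bound of \<open>coverable_many_edges\<close>. If none of these happened, summing that bound over the
  levels would give a weight below 1: the terms for the expected number of edges sum to at
  most a multiple of the total weight, the terms \<open>l ^ 3 / 2 ^ l\<close> have a small tail beyond \<open>40 * k\<close>, and
  the terms for the expected degrees sum to at most half of the weight of \<open>S\<close> under \<open>h\<close>.
\<close>

theorem p_small_if_codegree_le_square:
  fixes g :: "'a set \<Rightarrow> real" and p :: real
  assumes finX: "finite X" and k: "k \<ge> 1" and p: "0 \<le> p"
    and g0: "\<And>T. T \<subseteq> X \<Longrightarrow> 0 \<le> g T"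
    and unif: "\<And>T. T \<subseteq> X \<Longrightarrow> g T \<noteq> 0 \<Longrightarrow> card T = k"
    and codeg: "\<And>u v. u \<noteq> v \<Longrightarrow> card {T \<in> Pow X. g T \<noteq> 0 \<and> u \<in> T \<and> v \<in> T} \<le> k\<^sup>2"
    and weight: "fun_weight X g p \<le> 1 / 2 ^ (50 * k)"
  shows "p_small X p (fun_upset X g)"
proof -
  define H where "H = {T \<in> Pow X. g T \<noteq> 0}"
  have finH: "finite H" using finX by (simp add: H_def)
  have edge: "T \<subseteq> X \<and> card T = k" if "T \<in> H" for T
    using that unif by (auto simp: H_def)
  have gH: "0 \<le> g T" if "T \<in> H" for T using that g0 by (auto simp: H_def)
  define z :: real where "z = 2 ^ k"
  define \<epsilon> where "\<epsilon> = sum g H * p ^ k"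
  (* Every quantity that is polynomial in k is bounded by a power of z = 2 ^ k, of which the
     weight bound supplies 50. *)
  have z2: "2 \<le> z" unfolding z_def using k power_increasing[of 1 k "2::real"] by simp
  have kz: "2 * real k \<le> z"
  proof -
    have "2 * j \<le> 2 ^ j" if "1 \<le> j" for j :: nat
      using that by (induction j rule: nat_induct_at_least) auto
    then have "2 * k \<le> 2 ^ k" using k by simp
    then have "real (2 * k) \<le> real (2 ^ k)" by (simp only: of_nat_le_iff)
    then show ?thesis by (simp add: z_def)
  qed
  then have k_le_z: "real k \<le> z" by simp
  have "\<epsilon> = (\<Sum>T\<in>H. g T * p ^ card T)"
    unfolding \<epsilon>_def sum_distrib_right using edge by (intro sum.cong) auto
  also have "\<dots> = fun_weight X g p"
    unfolding fun_weight_def H_def using finX by (intro sum.mono_neutral_left) auto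
  finally have "\<epsilon> \<le> 1 / z ^ 50"
    using weight by (simp add: z_def power_mult mult.commute flip: power_mult)
  then have \<epsilon>_le: "\<epsilon> * z ^ 50 \<le> 1" using z2 by (simp add: field_simps)
  have \<epsilon>0: "0 \<le> \<epsilon>" using gH p by (simp add: \<epsilon>_def sum_nonneg)
  have \<epsilon>_power: "\<epsilon> * z ^ j \<le> 1 / 2 ^ (50 - j)" if "j \<le> 50" for j
  proof -
    have "\<epsilon> * z ^ j * 2 ^ (50 - j) \<le> \<epsilon> * z ^ j * z ^ (50 - j)"
      using z2 \<epsilon>0 by (intro mult_left_mono power_mono) auto
    also have "\<dots> = \<epsilon> * z ^ 50" using that by (simp flip: power_add)
    finally show ?thesis using \<epsilon>_le by (simp add: field_simps)
  qed
  define \<Theta> where "\<Theta> = real (32 * k ^ 3 * k\<^sup>2)"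
  have \<Theta>0: "0 \<le> \<Theta>" by (simp add: \<Theta>_def)
  have \<Theta>_le: "\<Theta> \<le> z ^ 5"
  proof -
    have "\<Theta> = (2 * real k) ^ 5" by (simp add: \<Theta>_def power_mult_distrib flip: power_add)
    also have "\<dots> \<le> z ^ 5" using kz by (intro power_mono) auto
    finally show ?thesis .
  qed
  define a where "a = 40 * k"
  have z_a: "2 ^ a = z ^ 40" by (simp add: a_def z_def power_mult mult.commute flip: power_mult)

  (* The threshold 1 / 2 ^ a has to be small enough for the tail of l ^ 3 / 2 ^ l beyond a to
     outweigh Theta, and large enough for the edges above it to be listed: they cost at
     most 2 ^ a times the total weight. *)
  define Big where "Big = {T \<in> H. 1 / 2 ^ a < g T}"
  have big: "coverable X p (1/8) {S \<in> Pow X. \<exists>T\<in>Big. T \<subseteq> S}"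
  proof (rule coverable_image[OF _ p])
    have "(\<Sum>T\<in>Big. p ^ card T) \<le> (\<Sum>T\<in>Big. 2 ^ a * (g T * p ^ k))"
    proof (rule sum_mono)
      fix T assume "T \<in> Big"
      then have "card T = k" "1 \<le> 2 ^ a * g T" using edge by (auto simp: Big_def field_simps)
      then show "p ^ card T \<le> 2 ^ a * (g T * p ^ k)"
        using mult_right_mono[of 1 "2 ^ a * g T" "p ^ k"] p by (simp add: ac_simps)
    qed
    also have "\<dots> \<le> (\<Sum>T\<in>H. 2 ^ a * (g T * p ^ k))"
      using finH gH p by (intro sum_mono2) (auto simp: Big_def)
    also have "\<dots> = \<epsilon> * z ^ 40"
      unfolding \<epsilon>_def z_a[symmetric] by (simp add: sum_distrib_left sum_distrib_right ac_simps)
    also have "\<dots> \<le> 1 / 8" using \<epsilon>_power[of 40] by simp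
    finally show "(\<Sum>T\<in>Big. p ^ card T) \<le> 1 / 8" .
  qed (use finH edge in \<open>auto simp: Big_def\<close>)

  (* The factor 4 * Theta * exp 5 is chosen so that the degree terms of b l S, summed over
     all levels, amount to at most half of the sum of h over S. *)
  define deg where "deg v = (\<Sum>T\<in>edges_at H v. g T) * p ^ (k - 1)" for v
  have deg0: "0 \<le> deg v" for v
    unfolding deg_def using gH p by (intro mult_nonneg_nonneg sum_nonneg) (auto simp: edges_at_def)
  define h where "h v = 4 * \<Theta> * exp 5 * deg v" for v
  have exp5: "exp (5::real) \<le> 2 ^ 8" using exp_le_power_3[of 5] by simp
  have exp6: "exp (6::real) \<le> 2 ^ 10" using exp_le_power_3[of 6] by simp
  have heavy: "coverable X p (1/8) {S \<in> Pow X. 1 \<le> sum h S}"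
  proof (rule coverable_heavy_points[OF finX p])
    show "0 \<le> h v" for v using deg0 \<Theta>0 by (simp add: h_def)
    have "(\<Sum>v\<in>X. p * h v) = 4 * \<Theta> * exp 5 * (\<Sum>v\<in>X. p * deg v)"
      by (simp add: h_def sum_distrib_left ac_simps)
    also have "(\<Sum>v\<in>X. p * deg v) = (\<Sum>v\<in>X. (\<Sum>T\<in>edges_at H v. g T) * p ^ k)"
      unfolding deg_def using k by (intro sum.cong) (auto simp: power_eq_if)
    also have "\<dots> = k * \<epsilon>"
      using sum_weighted_degrees[OF finX finH edge, of g]
      by (simp add: \<epsilon>_def flip: sum_distrib_right)
    also have "4 * \<Theta> * exp 5 * (k * \<epsilon>) \<le> 4 * z ^ 5 * 2 ^ 8 * (z * \<epsilon>)"
      using \<Theta>_le \<Theta>0 exp5 kz \<epsilon>0 z2 by (intro mult_mono) auto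
    also have "\<dots> = 2 ^ 10 * (\<epsilon> * z ^ 6)" by (simp add: power_add[symmetric] power_eq_if[of z 6] ac_simps)
    also have "\<dots> \<le> 2 ^ 10 * (1 / 2 ^ 44)" using \<epsilon>_power[of 6] by (intro mult_left_mono) auto
    also have "\<dots> \<le> 1 / 1000" by simp
    finally show "(\<Sum>v\<in>X. p * h v) \<le> 1 / 1000" .
  qed

  obtain m where m: "\<forall>Z\<subseteq>H. (\<forall>T\<in>Z. g T \<le> 1 / 2 ^ a) \<longrightarrow>
      sum g Z \<le> (\<Sum>l\<in>{a..<m}. card (dyadic g l Z) / 2 ^ l)"
    by (rule sum_le_sum_dyadic[where Y = H and h = g and a = a, OF finH gH])
  define L where "L l = dyadic g l H" for l
  have L_H: "L l \<subseteq> H" for l by (auto simp: L_def dyadic_def)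
  define b where "b l S = \<Theta> * (4 * exp 6 * (k * card (L l) * p ^ k) + real l ^ 3 +
      exp 5 * (\<Sum>v\<in>S. link_weight (L l) k p v))" for l S
  define Many where "Many l = {S \<in> Pow X. b l S < card {T \<in> L l. T \<subseteq> S}}" for l
  have many: "coverable X p (3 * exp (- real l)) (Many l)" if l: "l \<in> {a..<m}" for l
    unfolding Many_def b_def \<Theta>_def
  proof (rule coverable_many_edges[OF finX _ k _ _ p])
    show "T \<subseteq> X \<and> card T = k" if "T \<in> L l" for T
      by (rule edge[OF subsetD[OF L_H that]])
    show "1 \<le> k\<^sup>2" using k by simp
    show "card {T \<in> L l. u \<in> T \<and> v \<in> T} \<le> k\<^sup>2" if "u \<noteq> v" for u v
    proof -
      have "card {T \<in> L l. u \<in> T \<and> v \<in> T} \<le> card {T \<in> Pow X. g T \<noteq> 0 \<and> u \<in> T \<and> v \<in> T}"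
        using finX L_H by (intro card_mono) (auto simp: H_def)
      then show ?thesis using codeg[OF that] by simp
    qed
    have "card (L l) / 2 ^ l \<le> 2 * sum g H"
      using sum_dyadic_le[where Y = H and h = g and L = "{l}", OF finH gH] by (simp add: L_def)
    then have "card (L l) / 2 ^ l * p ^ k \<le> 2 * sum g H * p ^ k"
      using p by (intro mult_right_mono) auto
    then have "card (L l) * p ^ k \<le> 2 ^ l * (2 * \<epsilon>)"
      by (simp add: \<epsilon>_def field_simps)
    then have "real k * (card (L l) * p ^ k) * exp 6 \<le> z * (2 ^ l * (2 * \<epsilon>)) * 2 ^ 10"
      by (rule mult_mono[OF mult_mono[OF k_le_z]]) (use exp6 p \<epsilon>0 z2 in auto)
    also have "\<dots> = 2 ^ l * (2 ^ 11 * (\<epsilon> * z ^ 1))" by simp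
    also have "\<dots> \<le> 2 ^ l * (2 ^ 11 * (1 / 2 ^ 49))"
      using \<epsilon>_power[of 1] by (intro mult_left_mono) auto
    also have "\<dots> \<le> 2 ^ l" by simp
    also have "\<dots> \<le> exp 1 ^ l" using two_le_exp_1 by (intro power_mono) auto
    also have "\<dots> = exp (real l)" by (simp flip: exp_of_nat_mult)
    also have "\<dots> \<le> exp (2 * real l)" by simp
    finally show "real (k * card (L l)) * p ^ k * exp 6 \<le> exp (2 * real l)"
      by (simp add: ac_simps)
  qed
  have "coverable X p (\<Sum>l\<in>{a..<m}. 3 * exp (- real l)) (\<Union>l\<in>{a..<m}. Many l)"
    using coverable_UN[OF finX p finite_atLeastLessThan many] .
  from coverable_Un[OF finX p coverable_Un[OF finX p big heavy] this]
  show ?thesis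
    unfolding p_small_iff_coverable
  proof (rule coverable_mono)
    have "(\<Sum>l\<in>{a..<m}. 3 * exp (- real l)) \<le> (\<Sum>l\<in>{a..<m}. 3 * (1/2) ^ l)"
      using exp_neg_le_half_power by (intro sum_mono) auto
    also have "\<dots> = 3 * (\<Sum>l\<in>{a..<m}. (1/2) ^ l)" by (simp add: sum_distrib_left)
    also have "\<dots> \<le> 3 * ((1/2) ^ a / (1 - 1/2))"
      by (intro mult_left_mono sum_power_le) auto
    also have "\<dots> \<le> 3 * ((1/2) ^ 40 / (1 - 1/2))"
      using k by (intro mult_left_mono divide_right_mono power_decreasing) (auto simp: a_def)
    also have "\<dots> \<le> 1 / 4" by (simp add: power_one_over)
    finally show "1 / 8 + 1 / 8 + (\<Sum>l\<in>{a..<m}. 3 * exp (- real l)) \<le> (1/2::real)" by simp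
  next
    show "fun_upset X g \<subseteq> {S \<in> Pow X. \<exists>T\<in>Big. T \<subseteq> S} \<union> {S \<in> Pow X. 1 \<le> sum h S} \<union> (\<Union>l\<in>{a..<m}. Many l)"
    proof (rule subsetI, rule ccontr)
      fix S assume SF: "S \<in> fun_upset X g"
        and "S \<notin> {S \<in> Pow X. \<exists>T\<in>Big. T \<subseteq> S} \<union> {S \<in> Pow X. 1 \<le> sum h S} \<union> (\<Union>l\<in>{a..<m}. Many l)"
      then have S: "S \<subseteq> X" "1 \<le> sum g (Pow S)" and noBig: "\<forall>T\<in>Big. \<not> T \<subseteq> S"
        and hS: "sum h S < 1" and few: "\<forall>l\<in>{a..<m}. card {T \<in> L l. T \<subseteq> S} \<le> b l S"
        by (auto simp: fun_upset_def Many_def not_less not_le)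
      have finS: "finite S" using S(1) finX by (rule finite_subset)
      define HS where "HS = {T \<in> H. T \<subseteq> S}"
      have "sum g (Pow S) = sum g HS"
        using finS S(1) by (intro sum.mono_neutral_right) (auto simp: HS_def H_def)
      also have "\<dots> \<le> (\<Sum>l\<in>{a..<m}. card (dyadic g l HS) / 2 ^ l)"
        using noBig by (intro m[rule_format]) (auto simp: HS_def Big_def not_less)
      also have "\<dots> \<le> (\<Sum>l\<in>{a..<m}. b l S / 2 ^ l)"
      proof (intro sum_mono divide_right_mono)
        fix l assume l: "l \<in> {a..<m}"
        have "dyadic g l HS = {T \<in> L l. T \<subseteq> S}" by (auto simp: dyadic_def HS_def L_def)
        then show "card (dyadic g l HS) \<le> b l S" using few l by auto
      qed simp
      also have "\<dots> = \<Theta> * (4 * exp 6 * (k * p ^ k * (\<Sum>l\<in>{a..<m}. card (L l) / 2 ^ l)))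
          + \<Theta> * (\<Sum>l\<in>{a..<m}. real l ^ 3 / 2 ^ l)
          + \<Theta> * exp 5 * (\<Sum>l\<in>{a..<m}. (\<Sum>v\<in>S. link_weight (L l) k p v) / 2 ^ l)"
        by (simp add: b_def add_divide_distrib distrib_left sum.distrib sum_distrib_left ac_simps)
      also have "\<dots> \<le> 1/8 + 1/8 + 1/2 * sum h S"
      proof (intro add_mono)
        have "(\<Sum>l\<in>{a..<m}. card (L l) / 2 ^ l) \<le> 2 * sum g H"
          unfolding L_def using finH gH by (intro sum_dyadic_le) auto
        then have "k * p ^ k * (\<Sum>l\<in>{a..<m}. card (L l) / 2 ^ l) \<le> k * p ^ k * (2 * sum g H)"
          using p by (intro mult_left_mono) auto
        also have "\<dots> = (2 * real k) * \<epsilon>" by (simp add: \<epsilon>_def)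
        also have "\<dots> \<le> z * \<epsilon>" using kz \<epsilon>0 by (intro mult_right_mono) auto
        finally have 1: "k * p ^ k * (\<Sum>l\<in>{a..<m}. card (L l) / 2 ^ l) \<le> z * \<epsilon>" .
        have "\<Theta> * (4 * exp 6 * (k * p ^ k * (\<Sum>l\<in>{a..<m}. card (L l) / 2 ^ l)))
            \<le> z ^ 5 * (4 * 2 ^ 10 * (z * \<epsilon>))"
          by (rule mult_mono[OF \<Theta>_le mult_mono[OF _ 1]])
            (use exp6 p z2 in \<open>auto intro!: mult_nonneg_nonneg sum_nonneg\<close>)
        also have "\<dots> = 2 ^ 12 * (\<epsilon> * z ^ 6)" by (simp add: power_eq_if[of z 6] ac_simps)
        also have "\<dots> \<le> 2 ^ 12 * (1 / 2 ^ 44)" using \<epsilon>_power[of 6] by (intro mult_left_mono) auto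
        also have "\<dots> \<le> 1 / 8" by simp
        finally show "\<Theta> * (4 * exp 6 * (k * p ^ k * (\<Sum>l\<in>{a..<m}. card (L l) / 2 ^ l))) \<le> 1 / 8" .
      next
        have "(3/4::real) ^ a = ((3/4) ^ 40) ^ k" by (simp add: a_def power_mult)
        also have "\<dots> \<le> (1 / 2 ^ 16) ^ k"
          by (intro power_mono) (simp_all add: power_divide)
        also have "\<dots> = 1 / z ^ 16"
          by (simp only: z_def power_one_over power_mult[symmetric] mult.commute)
        finally have "\<Theta> * (\<Sum>l\<in>{a..<m}. real l ^ 3 / 2 ^ l) \<le> z ^ 5 * (128 * (1 / z ^ 16))"
          using \<Theta>_le \<Theta>0 z2 sum_cube_over_power[of a m] k
          by (intro mult_mono) (auto simp: a_def intro!: sum_nonneg)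
        also have "\<dots> = 128 / z ^ 11"
          using z2 by (simp add: field_simps flip: power_add)
        also have "\<dots> \<le> 128 / 2 ^ 11"
          using z2 by (intro divide_left_mono power_mono) auto
        also have "\<dots> \<le> 1 / 8" by simp
        finally show "\<Theta> * (\<Sum>l\<in>{a..<m}. real l ^ 3 / 2 ^ l) \<le> 1 / 8" .
      next
        have "(\<Sum>l\<in>{a..<m}. (\<Sum>v\<in>S. link_weight (L l) k p v) / 2 ^ l)
            = (\<Sum>l\<in>{a..<m}. \<Sum>v\<in>S. p ^ (k - 1) * (card (edges_at (L l) v) / 2 ^ l))"
          by (simp add: link_weight_def sum_divide_distrib ac_simps)
        also have "\<dots> = (\<Sum>v\<in>S. p ^ (k - 1) * (\<Sum>l\<in>{a..<m}. card (edges_at (L l) v) / 2 ^ l))"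
          by (subst sum.swap) (simp add: sum_distrib_left)
        also have "\<dots> \<le> (\<Sum>v\<in>S. 2 * deg v)"
        proof (rule sum_mono)
          fix v
          have "edges_at (L l) v = dyadic g l (edges_at H v)" for l
            by (auto simp: edges_at_def L_def dyadic_def)
          then have "(\<Sum>l\<in>{a..<m}. card (edges_at (L l) v) / 2 ^ l) \<le> 2 * sum g (edges_at H v)"
            using finH gH sum_dyadic_le[of "edges_at H v" g "{a..<m}"] by (simp add: edges_at_def)
          then have "p ^ (k - 1) * (\<Sum>l\<in>{a..<m}. card (edges_at (L l) v) / 2 ^ l)
              \<le> p ^ (k - 1) * (2 * sum g (edges_at H v))"
            using p by (intro mult_left_mono) auto
          then show "p ^ (k - 1) * (\<Sum>l\<in>{a..<m}. card (edges_at (L l) v) / 2 ^ l) \<le> 2 * deg v"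
            by (simp add: deg_def ac_simps)
        qed
        finally have "\<Theta> * exp 5 * (\<Sum>l\<in>{a..<m}. (\<Sum>v\<in>S. link_weight (L l) k p v) / 2 ^ l)
            \<le> \<Theta> * exp 5 * (\<Sum>v\<in>S. 2 * deg v)"
          using \<Theta>0 by (intro mult_left_mono) auto
        also have "\<dots> = 1/2 * sum h S"
          by (simp add: h_def sum_distrib_left ac_simps)
        finally show "\<Theta> * exp 5 * (\<Sum>l\<in>{a..<m}. (\<Sum>v\<in>S. link_weight (L l) k p v) / 2 ^ l)
            \<le> 1/2 * sum h S" .
      qed
      also have "\<dots> < 1" using hS by simp
      finally show False using S(2) by simp
    qed
  qed
qed

section \<open>Arithmetic progressions\<close>

text \<open>
  The positions of two of its terms determine a progression: the difference is the quotient of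
  the distance of the terms by the distance of their positions.
\<close>

lemma card_APs_through_pair:
  assumes "u \<noteq> v" "\<And>T. T \<in> A \<Longrightarrow> is_AP k T \<and> u \<in> T \<and> v \<in> T"
  shows "card A \<le> k\<^sup>2"
  using assms
proof (induction u v rule: linorder_less_wlog)
  case (less u v)
  define f where "f = (\<lambda>(i, j). (\<lambda>x. (u - i * ((v - u) div (j - i))) + x * ((v - u) div (j - i))) ` {..<k})"
  have "A \<subseteq> f ` ({..<k} \<times> {..<k})"
  proof
    fix T assume "T \<in> A"
    then have T: "is_AP k T" "u \<in> T" "v \<in> T" using less.prems by auto
    then obtain a d where d: "d \<noteq> 0" and Tad: "T = (\<lambda>i. a + i * d) ` {..<k}"
      by (auto simp: is_AP_def)
    obtain i j where ij: "i < k" "j < k" "u = a + i * d" "v = a + j * d"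
      using T Tad by auto
    then have "i < j" using less.hyps d by simp
    moreover have "v - u = (j - i) * d" using ij by (simp add: diff_mult_distrib)
    ultimately have "(v - u) div (j - i) = d" by simp
    then have "f (i, j) = T" using ij Tad by (simp add: f_def)
    then show "T \<in> f ` ({..<k} \<times> {..<k})" using ij by force
  qed
  then have "card A \<le> card ({..<k} \<times> {..<k})"
    by (intro surj_card_le) auto
  then show ?case by (simp add: power2_eq_square)
next
  case (refl u)
  then show ?case by simp
next
  case (sym u v)
  then show ?case by auto
qed

theorem corollary13:
  shows "\<exists>C::real. C > 1 \<and>
    (\<forall>(n::nat) (k::nat) (X::nat set) (f :: nat set \<Rightarrow> real) (g :: nat set \<Rightarrow> real) (p::real).
      n \<ge> 1 \<longrightarrow> k \<ge> 1 \<longrightarrow> X = {1..n} \<longrightarrow>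
      f \<in> nsets X k \<rightarrow> {0..1} \<longrightarrow> g = zero_extension (nsets X k) f \<longrightarrow>
      (\<forall>S \<in> support_on (Pow X) g. is_AP k S) \<longrightarrow>
      p \<in> {0..1} \<longrightarrow> fun_weight X g p = 1 \<longrightarrow>
      p_small X (p / C) (fun_upset X g))"
proof (intro exI[of _ "2 ^ 50"] conjI allI impI)
  fix n k :: nat and X :: "nat set" and f g :: "nat set \<Rightarrow> real" and p :: real
  assume k: "1 \<le> k" and X: "X = {1..n}" and f: "f \<in> nsets X k \<rightarrow> {0..1}"
    and g: "g = zero_extension (nsets X k) f" and AP: "\<forall>S\<in>support_on (Pow X) g. is_AP k S"
    and p: "p \<in> {0..1}" and weight: "fun_weight X g p = 1"
  have unif: "card T = k" if "g T \<noteq> 0" for T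
    using that by (auto simp: g zero_extension_def nsets_def split: if_splits)
  show "p_small X (p / 2 ^ 50) (fun_upset X g)"
  proof (rule p_small_if_codegree_le_square[OF _ k])
    show "finite X" by (simp add: X)
    show "0 \<le> p / 2 ^ 50" using p by simp
    show "0 \<le> g T" for T
      using f by (auto simp: g zero_extension_def Pi_iff)
    show "card T = k" if "g T \<noteq> 0" for T using that by (rule unif)
    show "card {T \<in> Pow X. g T \<noteq> 0 \<and> u \<in> T \<and> v \<in> T} \<le> k\<^sup>2" if "u \<noteq> v" for u v
      using that by (rule card_APs_through_pair) (use AP in \<open>auto simp: support_on_def\<close>)
    have "fun_weight X g (p / 2 ^ 50) = (\<Sum>T\<in>Pow X. g T * p ^ card T / 2 ^ (50 * k))"
      unfolding fun_weight_def
    proof (rule sum.cong[OF refl])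
      fix T
      show "g T * (p / 2 ^ 50) ^ card T = g T * p ^ card T / 2 ^ (50 * k)"
        using unif[of T] by (cases "g T = 0") (simp_all add: power_divide power_mult)
    qed
    also have "\<dots> = fun_weight X g p / 2 ^ (50 * k)"
      by (simp add: fun_weight_def sum_divide_distrib)
    finally show "fun_weight X g (p / 2 ^ 50) \<le> 1 / 2 ^ (50 * k)"
      using weight by simp
  qed
qed simp

end
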